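(* Let $\alpha$ be an irrational real number and let $$f(z)=\sum_{n=0}^\infty e^{2\pi i n^2\alpha}\,\frac{z^n}{n!}.$$ Then $f$ is of completely regular growth in the sense of Levin–Pfluger (with respect to order $\rho=1$), and its indicator satisfies $h_f(\theta)=1$ for all $\theta$.
   Context: An entire function $f$ of order $\rho>0$ and normal type is called of completely regular growth (in the sense of Levin–Pfluger) if the limit $$u=\lim_{t\to\infty} t^{-\rho}\log|f(tz)|$$ exists in the space $D'$ of Schwartz distributions in the plane (as functions of $z$). Normal type means $0<\limsup_{r\to\infty}r^{-\rho}\log\max_{|z|=r}|f(z)|<\infty$. The indicator for order $\rho=1$ is $h_f(\theta)=\limsup_{r\to\infty}r^{-1}\log|f(re^{i\theta})|$. *)

theory Defs
  imports "HOL-Analysis.Analysis"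
begin

text \<open>The plane is the type \<^typ>\<open>complex\<close>, regarded as a real normed space of dimension two; its
  Lebesgue measure is \<^term>\<open>lborel :: complex measure\<close>. Differentiability below is always real
  differentiability.\<close>

definition dir_deriv :: "complex \<Rightarrow> (complex \<Rightarrow> complex) \<Rightarrow> complex \<Rightarrow> complex" where
  "dir_deriv v \<phi> = (\<lambda>z. frechet_derivative \<phi> (at z) v)"

primrec C_k :: "nat \<Rightarrow> (complex \<Rightarrow> complex) \<Rightarrow> bool" where
  "C_k 0 \<phi> \<longleftrightarrow> continuous_on UNIV \<phi>"
| "C_k (Suc k) \<phi> \<longleftrightarrow> \<phi> differentiable_on UNIV \<and> (\<forall>v. C_k k (dir_deriv v \<phi>))"

definition smooth :: "(complex \<Rightarrow> complex) \<Rightarrow> bool" where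
  "smooth \<phi> \<longleftrightarrow> (\<forall>k. C_k k \<phi>)"

definition supp :: "(complex \<Rightarrow> complex) \<Rightarrow> complex set" where
  "supp \<phi> = closure {z. \<phi> z \<noteq> 0}"

definition test_functions :: "(complex \<Rightarrow> complex) set" where
  "test_functions = {\<phi>. smooth \<phi> \<and> compact (supp \<phi>)}"

definition partial_deriv :: "nat \<Rightarrow> nat \<Rightarrow> (complex \<Rightarrow> complex) \<Rightarrow> complex \<Rightarrow> complex" where
  "partial_deriv i j \<phi> = (dir_deriv 1 ^^ i) ((dir_deriv \<i> ^^ j) \<phi>)"

text \<open>A distribution is a linear functional on the test functions that is continuous, in the usual
  seminorm formulation: on the test functions supported in a fixed compact set it is bounded by
  finitely many sup-norms of derivatives. Only its values on test functions matter.\<close>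

definition distribution :: "((complex \<Rightarrow> complex) \<Rightarrow> complex) \<Rightarrow> bool" where
  "distribution u \<longleftrightarrow>
     (\<forall>\<phi>\<in>test_functions. \<forall>\<psi>\<in>test_functions. u (\<lambda>z. \<phi> z + \<psi> z) = u \<phi> + u \<psi>) \<and>
     (\<forall>c. \<forall>\<phi>\<in>test_functions. u (\<lambda>z. c * \<phi> z) = c * u \<phi>) \<and>
     (\<forall>K. compact K \<longrightarrow> (\<exists>C N. \<forall>\<phi>\<in>test_functions. supp \<phi> \<subseteq> K \<longrightarrow>
        norm (u \<phi>) \<le> C * (\<Sum>i\<le>N. \<Sum>j\<le>N. SUP z. norm (partial_deriv i j \<phi> z))))"

definition locally_integrable :: "(complex \<Rightarrow> real) \<Rightarrow> bool" where
  "locally_integrable g \<longleftrightarrow> (\<forall>K. compact K \<longrightarrow> set_integrable lborel K g)"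

definition regular_distribution :: "(complex \<Rightarrow> real) \<Rightarrow> (complex \<Rightarrow> complex) \<Rightarrow> complex" where
  "regular_distribution g \<phi> = (\<integral>z. g z *\<^sub>R \<phi> z \<partial>lborel)"

text \<open>Convergence in \<open>D'\<close> of a family of functions, each identified with the distribution it
  induces. Local integrability is required because otherwise the integrals above would be
  meaningless (the library gives a non-integrable function the integral 0).\<close>

definition tendsto_distribution ::
    "('i \<Rightarrow> complex \<Rightarrow> real) \<Rightarrow> ((complex \<Rightarrow> complex) \<Rightarrow> complex) \<Rightarrow> 'i filter \<Rightarrow> bool" where
  "tendsto_distribution g u F \<longleftrightarrow>
     distribution u \<and> (\<forall>\<^sub>F t in F. locally_integrable (g t)) \<and>
     (\<forall>\<phi>\<in>test_functions. ((\<lambda>t. regular_distribution (g t) \<phi>) \<longlongrightarrow> u \<phi>) F)"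

definition max_modulus :: "(complex \<Rightarrow> complex) \<Rightarrow> real \<Rightarrow> real" where
  "max_modulus f r = (SUP z\<in>sphere 0 r. norm (f z))"

definition has_growth_order :: "(complex \<Rightarrow> complex) \<Rightarrow> real \<Rightarrow> bool" where
  "has_growth_order f \<rho> \<longleftrightarrow>
     Limsup at_top (\<lambda>r. ereal (ln (ln (max_modulus f r)) / ln r)) = ereal \<rho>"

definition growth_type :: "real \<Rightarrow> (complex \<Rightarrow> complex) \<Rightarrow> ereal" where
  "growth_type \<rho> f = Limsup at_top (\<lambda>r. ereal (r powr (-\<rho>) * ln (max_modulus f r)))"

definition normal_type :: "real \<Rightarrow> (complex \<Rightarrow> complex) \<Rightarrow> bool" where
  "normal_type \<rho> f \<longleftrightarrow> 0 < growth_type \<rho> f \<and> growth_type \<rho> f < \<infinity>"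

text \<open>The library convention \<^prop>\<open>ln (0 :: real) = 0\<close> is harmless in the next definition: a function
  of normal type is not identically zero, so its zeros form a null set.\<close>

definition completely_regular_growth :: "real \<Rightarrow> (complex \<Rightarrow> complex) \<Rightarrow> bool" where
  "completely_regular_growth \<rho> f \<longleftrightarrow>
     0 < \<rho> \<and> f holomorphic_on UNIV \<and> has_growth_order f \<rho> \<and> normal_type \<rho> f \<and>
     (\<exists>u. tendsto_distribution
            (\<lambda>t z. t powr (-\<rho>) * ln (norm (f (of_real t * z)))) u at_top)"

text \<open>On a single ray the zeros may matter for an upper limit, so here the logarithm of 0 is
  \<open>-\<infinity>\<close>.\<close>

definition log_modulus :: "complex \<Rightarrow> ereal" where
  "log_modulus w = (if w = 0 then -\<infinity> else ereal (ln (norm w)))"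

definition growth_indicator :: "real \<Rightarrow> (complex \<Rightarrow> complex) \<Rightarrow> real \<Rightarrow> ereal" where
  "growth_indicator \<rho> f \<theta> =
     Limsup at_top (\<lambda>r. ereal (r powr (-\<rho>)) * log_modulus (f (of_real r * cis \<theta>)))"

end

theory Submission
  imports Defs "HOL-Complex_Analysis.Complex_Analysis" "HOL-Real_Asymp.Real_Asymp"
begin

text \<open>The function satisfies \<open>f' z = c f (q z)\<close> with \<open>\<bar>c\<bar> = \<bar>q\<bar> = 1\<close>, hence \<open>\<bar>f\<^sup>(\<^sup>k\<^sup>) z\<bar> = \<bar>f (q\<^sup>k z)\<bar>\<close> and
  \<open>\<bar>f z\<bar> \<le> exp \<bar>z\<bar>\<close>. On each circle \<open>f\<close> nearly attains this bound, and Cauchy's inequality transports the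
  large value to the neighbourhood of every point of the circle, since the powers of \<open>q\<close> are dense in the
  unit circle. So the nonnegative function \<open>v\<^sub>t z = \<bar>z\<bar> - ln \<bar>f (t z)\<bar> / t\<close> is small at some point of every
  small disc. As \<open>ln \<bar>f\<bar>\<close> is subharmonic, the mean of \<open>v\<^sub>t\<close> over small discs is small too, so \<open>v\<^sub>t\<close> tends
  to \<open>0\<close> in \<open>L\<^sup>1\<close> on compact sets and the limit distribution is \<open>\<bar>z\<bar>\<close>. If the indicator were below \<open>1\<close> on
  some ray, then the maximum principle would make \<open>f\<close> too small in a whole neighbourhood of that ray.\<close>

section \<open>Invariance of Lebesgue measure under translations and linear isometries\<close>

lemma nn_integral_lborel_translation:
  fixes a :: "'a::euclidean_space"
  assumes [measurable]: "f \<in> borel_measurable borel"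
  shows "(\<integral>\<^sup>+x. f (x + a) \<partial>lborel) = (\<integral>\<^sup>+x. f x \<partial>lborel)"
proof -
  have "(\<integral>\<^sup>+x. f x \<partial>lborel) = (\<integral>\<^sup>+x. f x \<partial>distr lborel borel ((+) a))"
    by (simp add: lborel_distr_plus)
  also have "\<dots> = (\<integral>\<^sup>+x. f (x + a) \<partial>lborel)"
    by (subst nn_integral_distr) (simp_all add: add.commute)
  finally show ?thesis by simp
qed

text \<open>Uniqueness of the translation invariant measure: with \<open>B\<close> the unit ball and \<open>\<lambda>\<close> the Lebesgue
  measure, two applications of Fubini give \<open>\<lambda>(T\<^sup>-\<^sup>1 A) \<lambda>(B) = \<lambda>(A) \<lambda>(- T\<^sup>-\<^sup>1 B) = \<lambda>(A) \<lambda>(B)\<close>.\<close>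

lemma lborel_distr_linear_isometry:
  fixes T :: "'a::euclidean_space \<Rightarrow> 'a"
  assumes "linear T" and norm_T: "\<And>x. norm (T x) = norm x"
  shows "distr lborel borel T = lborel"
proof (rule measure_eqI)
  interpret T: linear T by fact
  have [measurable]: "T \<in> borel_measurable borel"
    by (intro borel_measurable_continuous_onI linear_continuous_on linear_conv_bounded_linear[THEN iffD1] \<open>linear T\<close>)
  have "inj T"
    using T.inj_iff_eq_0 norm_T norm_eq_zero by metis
  then have "surj T"
    using \<open>linear T\<close> linear_injective_imp_surjective by blast
  define B where "B = (cball 0 1 :: 'a set)"
  have [measurable]: "B \<in> sets borel" and B: "- T x \<in> B \<longleftrightarrow> x \<in> B" for x
    by (auto simp: B_def norm_T)
  fix A :: "'a set"
  assume "A \<in> sets (distr lborel borel T)"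
  then have [measurable]: "A \<in> sets borel" by simp
  \<comment> \<open>Substituting \<open>x + a\<close> for \<open>x\<close> with
    \<open>T a = y\<close> turns \<open>y - T x\<close> into \<open>- T x\<close>, and the ball is
    invariant under \<open>- T\<close>.\<close>
  have *: "(\<integral>\<^sup>+x. indicator A (T x) * indicator B (y - T x) \<partial>lborel)
      = (\<integral>\<^sup>+x. indicator A (y + T x) * indicator B x \<partial>lborel)" (is "?l = ?r") for y
  proof -
    obtain a where a: "T a = y" using \<open>surj T\<close> by (metis surj_def)
    have "?l = (\<integral>\<^sup>+x. indicator A (T (x + a)) * indicator B (y - T (x + a)) \<partial>lborel)"
      by (rule nn_integral_lborel_translation[symmetric]) measurable
    also have "\<dots> = ?r"
      by (intro nn_integral_cong) (simp add: T.add a add.commute indicator_def B)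
    finally show ?thesis .
  qed
  have "emeasure (distr lborel borel T) A * emeasure lborel B
      = (\<integral>\<^sup>+x. indicator A (T x) * (\<integral>\<^sup>+y. indicator B y \<partial>lborel) \<partial>lborel)"
    by (subst nn_integral_multc) (auto simp: emeasure_distr nn_integral_distr simp flip: nn_integral_indicator)
  also have "\<dots> = (\<integral>\<^sup>+x. (\<integral>\<^sup>+y. indicator A (T x) * indicator B (y - T x) \<partial>lborel) \<partial>lborel)"
  proof (intro nn_integral_cong)
    fix x
    have "(\<integral>\<^sup>+y. indicator B y \<partial>lborel) = (\<integral>\<^sup>+y. indicator B (y + (- T x)) \<partial>(lborel :: 'a measure))"
      by (rule nn_integral_lborel_translation[symmetric]) measurable
    then show "indicator A (T x) * (\<integral>\<^sup>+y. indicator B y \<partial>lborel) =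
      (\<integral>\<^sup>+y. indicator A (T x) * indicator B (y - T x) \<partial>lborel)"
      by (subst nn_integral_cmult) auto
  qed
  also have "\<dots> = (\<integral>\<^sup>+y. (\<integral>\<^sup>+x. indicator A (T x) * indicator B (y - T x) \<partial>lborel) \<partial>lborel)"
    by (rule lborel_pair.Fubini') measurable
  also have "\<dots> = (\<integral>\<^sup>+y. (\<integral>\<^sup>+x. indicator A (y + T x) * indicator B x \<partial>lborel) \<partial>lborel)"
    by (simp only: *)
  also have "\<dots> = (\<integral>\<^sup>+x. (\<integral>\<^sup>+y. indicator A (y + T x) * indicator B x \<partial>lborel) \<partial>lborel)"
    by (rule lborel_pair.Fubini') measurable
  also have "\<dots> = (\<integral>\<^sup>+x. emeasure lborel A * indicator B x \<partial>lborel)"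
    by (intro nn_integral_cong) (simp add: nn_integral_multc nn_integral_lborel_translation)
  also have "\<dots> = emeasure lborel A * emeasure lborel B"
    by (simp add: nn_integral_cmult_indicator)
  finally have "emeasure (distr lborel borel T) A * emeasure lborel B
      = emeasure lborel A * emeasure lborel B" .
  moreover have "emeasure lborel B \<noteq> 0" "emeasure lborel B \<noteq> \<infinity>"
    using unit_ball_vol_pos[of "real DIM('a)"]
    by (auto simp: B_def emeasure_cball simp del: unit_ball_vol_pos)
  ultimately show "emeasure (distr lborel borel T) A = emeasure lborel A"
    by (simp add: ennreal_mult_cancel_left mult.commute[of _ "emeasure lborel B"])
qed simp

text \<open>Multiplication by \<open>u\<close> is a linear isometry, hence preserves
  \<open>lborel\<close>, and it leaves the disc invariant.\<close>

lemma integral_cball_rotate: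
  fixes g :: "complex \<Rightarrow> real"
  assumes "norm u = 1" and [measurable]: "g \<in> borel_measurable borel"
  shows "(LINT z:cball 0 r|lborel. g (u * z)) = (LINT z:cball 0 r|lborel. g z)"
proof -
  have "distr lborel borel ((*) u) = lborel"
    using assms(1) by (intro lborel_distr_linear_isometry) (auto simp: norm_mult linear_times)
  then have "(LINT z:cball 0 r|lborel. g z) = (LINT z|distr lborel borel ((*) u). indicator (cball 0 r) z *\<^sub>R g z)"
    by (simp add: set_lebesgue_integral_def)
  also have "\<dots> = (LINT z|lborel. indicator (cball 0 r) (u * z) *\<^sub>R g (u * z))"
  proof (rule integral_distr)
    show "(*) u \<in> lborel \<rightarrow>\<^sub>M borel" by measurable
    show "(\<lambda>z. indicator (cball 0 r) z *\<^sub>R g z) \<in> borel_measurable borel"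
      using assms(2) by (intro borel_measurable_scaleR borel_measurable_indicator) auto
  qed
  also have "\<dots> = (LINT z:cball 0 r|lborel. g (u * z))"
    using assms(1) by (simp add: set_lebesgue_integral_def indicator_def norm_mult)
  finally show ?thesis by simp
qed

section \<open>Sub-mean value inequality over discs for the logarithm of a modulus\<close>

text \<open>A chord is no longer than its arc: the chord has length
  \<open>2 * \<bar>sin ((a - b) / 2)\<bar>\<close>.\<close>

lemma norm_cis_diff_le: "norm (cis a - cis b) \<le> \<bar>a - b\<bar>"
proof -
  have "norm (cis a - cis b) = norm (cis b * (exp (\<i> * of_real (a - b)) - 1))"
    by (simp add: cis_conv_exp algebra_simps flip: exp_add)
  also have "\<dots> = 2 * \<bar>sin ((a - b) / 2)\<bar>"
    by (simp only: norm_mult norm_cis dist_exp_i_1)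
  also have "\<dots> \<le> \<bar>a - b\<bar>"
    using abs_sin_x_le_abs_x[of "(a - b) / 2"] by simp
  finally show ?thesis .
qed

text \<open>Round the argument of \<open>c\<close> down to a multiple of \<open>2 * pi / n\<close>
  and compare chord with arc.\<close>

lemma roots_of_unity_dense:
  assumes "norm c = 1" and "n > 0"
  obtains u :: complex where "u ^ n = 1" "norm (c - u) \<le> 2 * pi / n"
proof
  define m where "m = \<lfloor>Arg c * n / (2 * pi)\<rfloor>"
  define u where "u = cis (2 * pi * of_int m / n)"
  show "u ^ n = 1"
    using assms(2) cis_multiple_2pi[of "of_int m"] by (simp add: u_def Complex.DeMoivre)
  have "\<bar>Arg c * n / (2 * pi) - of_int m\<bar> \<le> 1"
    unfolding m_def by linarith
  then have "2 * pi / n * \<bar>Arg c * n / (2 * pi) - of_int m\<bar> \<le> 2 * pi / n * 1"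
    by (intro mult_left_mono) auto
  moreover have "2 * pi / n * \<bar>Arg c * n / (2 * pi) - of_int m\<bar> = \<bar>Arg c - 2 * pi * of_int m / n\<bar>"
    using assms(2) by (simp add: field_simps flip: abs_mult abs_of_nonneg[of "2 * pi / n"])
  ultimately have "\<bar>Arg c - 2 * pi * of_int m / n\<bar> \<le> 2 * pi / n"
    by simp
  moreover have "c = cis (Arg c)"
    using assms(1) by (metis cis_Arg_unique rcis_cmod_Arg rcis_def mult_1 of_real_1)
  ultimately show "norm (c - u) \<le> 2 * pi / n"
    using norm_cis_diff_le[of "Arg c" "2 * pi * of_int m / n"] unfolding u_def by simp
qed

text \<open>The product of \<open>F (u z)\<close> over the roots of unity \<open>u\<close> attains at some point of each circle
  around \<open>0\<close> a modulus that is at least its modulus at \<open>0\<close>. Hence a Riemann sum of \<open>ln \<bar>F\<bar>\<close> over the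
  circle is at least \<open>ln \<bar>F 0\<bar>\<close>.\<close>

lemma ln_max_submean_at_0:
  assumes holF: "F holomorphic_on UNIV" and "F 0 \<noteq> 0" and "0 < \<epsilon>" and "0 \<le> r"
  shows "measure lborel (cball (0::complex) r) * ln (norm (F 0)) \<le> (LINT z:cball 0 r|lborel. ln (max (norm (F z)) \<epsilon>))"
proof -
  define G where "G z = ln (max (norm (F z)) \<epsilon>)" for z
  have contF: "continuous_on A F" for A
    using holF holomorphic_on_imp_continuous_on continuous_on_subset by blast
  have contG: "continuous_on A G" for A
    unfolding G_def using \<open>0 < \<epsilon>\<close> by (intro continuous_intros contF) (auto simp: max_def)
  have G_ge: "ln (norm (F z)) \<le> G z" if "F z \<noteq> 0" for z
    unfolding G_def using that \<open>0 < \<epsilon>\<close> by (subst ln_le_cancel_iff) auto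
  have intG: "set_integrable lborel (cball 0 r) (\<lambda>z. G (u * z))" for u
    unfolding set_integrable_def
    by (intro borel_integrable_compact) (auto intro!: continuous_intros continuous_on_compose2[OF contG])
  have 1: "measure lborel (cball (0::complex) r) * (ln (norm (F 0)) - \<eta>) \<le> (LINT z:cball 0 r|lborel. G z)"
    if "\<eta> > 0" for \<eta>
  proof -
    have "uniformly_continuous_on (cball 0 r) G"
      by (intro compact_uniformly_continuous contG) auto
    then obtain d where "d > 0"
      and d: "\<And>x y. x \<in> cball 0 r \<Longrightarrow> y \<in> cball 0 r \<Longrightarrow> dist y x < d \<Longrightarrow> dist (G y) (G x) < \<eta>"
      using \<open>\<eta> > 0\<close> unfolding uniformly_continuous_on_def by metis
    \<comment> \<open>With this \<open>n\<close>, replacing a unimodular factor by a nearby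
      \<open>n\<close>-th root of unity moves a point of the disc by less than the modulus of
      continuity \<open>d\<close>.\<close>
    obtain n :: nat where n: "2 * pi * r / d < n"
      using reals_Archimedean2 by blast
    moreover have "0 \<le> 2 * pi * r / d"
      using \<open>0 \<le> r\<close> \<open>d > 0\<close> by simp
    ultimately have "n > 0"
      using of_nat_0_less_iff[where 'a = real] by linarith
    with n \<open>d > 0\<close> have n': "2 * pi / n * r < d"
      by (simp add: field_simps)
    define U where "U = {u::complex. u ^ n = 1}"
    have "finite U"
      unfolding U_def using \<open>n > 0\<close> by (intro finite_roots_unity) simp
    moreover have "1 \<in> U"
      by (simp add: U_def)
    ultimately have "card U > 0"
      using card_gt_0_iff by blast
    have norm_U: "norm u = 1" if "u \<in> U" for u
      using that \<open>n > 0\<close> power_eq_1_iff[of u n] by (simp add: U_def)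
    have bound: "card U * (ln (norm (F 0)) - \<eta>) \<le> (\<Sum>u\<in>U. G (u * z))" if "z \<in> cball 0 r" for z
    proof -
      define P where "P x = (\<Prod>u\<in>U. F (u * x))" for x
      have holP: "P holomorphic_on A" for A
        unfolding P_def
        by (intro holomorphic_intros holomorphic_on_compose_gen[OF _ holF, unfolded o_def]) auto
      have "\<exists>x\<in>sphere 0 (norm z). \<forall>y\<in>sphere 0 (norm z). norm (P y) \<le> norm (P x)"
        by (intro continuous_attains_sup continuous_intros holomorphic_on_imp_continuous_on holP)
           (auto intro: exI[of _ z])
      then obtain x where x: "norm x = norm z"
        and x_max: "\<And>y. norm y = norm z \<Longrightarrow> norm (P y) \<le> norm (P x)"
        by auto
      have P0: "norm (P 0) \<le> norm (P x)"
        by (rule maximum_modulus_frontier[of _ "cball 0 (norm z)"])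
           (auto intro: x_max holP holomorphic_on_imp_continuous_on)
      have norm_P0: "norm (P 0) = norm (F 0) ^ card U"
        by (simp add: P_def norm_power)
      with P0 \<open>F 0 \<noteq> 0\<close> have "P x \<noteq> 0"
        by (metis norm_eq_zero norm_le_zero_iff power_not_zero)
      then have F_nz: "F (u * x) \<noteq> 0" if "u \<in> U" for u
        using that \<open>finite U\<close> by (auto simp: P_def)
      have "card U * ln (norm (F 0)) = ln (norm (P 0))"
        using \<open>F 0 \<noteq> 0\<close> by (simp add: norm_P0 ln_realpow)
      also have "\<dots> \<le> ln (norm (P x))"
        using P0 \<open>F 0 \<noteq> 0\<close> by (subst ln_le_cancel_iff) (auto simp: norm_P0 \<open>P x \<noteq> 0\<close>)
      also have "\<dots> = (\<Sum>u\<in>U. ln (norm (F (u * x))))"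
        unfolding P_def prod_norm[symmetric] using F_nz \<open>finite U\<close> by (subst ln_prod) auto
      also have "\<dots> \<le> (\<Sum>u\<in>U. G (u * x))"
        by (intro sum_mono G_ge F_nz)
      finally have Sx: "card U * ln (norm (F 0)) \<le> (\<Sum>u\<in>U. G (u * x))" .
      obtain c where c: "norm c = 1" "x = c * z"
      proof (cases "z = 0")
        case True
        then show ?thesis using x that[of 1] by simp
      next
        case False
        then show ?thesis using x that[of "x / z"] by (simp add: norm_divide)
      qed
      \<comment> \<open>The maximum point \<open>x\<close> is \<open>z\<close> rotated by an
        arbitrary \<open>c\<close>. Replacing \<open>c\<close> by the root of unity \<open>v\<close>
        changes each value of \<open>G\<close> by less than \<eta>, and multiplication by
        \<open>v\<close> only permutes \<open>U\<close>.\<close>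
      obtain v where v: "v ^ n = 1" "norm (c - v) \<le> 2 * pi / n"
        using roots_of_unity_dense[OF c(1) \<open>n > 0\<close>] by blast
      have "v \<noteq> 0" using v(1) \<open>n > 0\<close> by (auto simp: power_0_left)
      have "(\<Sum>u\<in>U. G (u * x) - \<eta>) \<le> (\<Sum>u\<in>U. G (u * v * z))"
      proof (rule sum_mono)
        fix u assume u: "u \<in> U"
        have "norm v = 1" using v(1) norm_U by (simp add: U_def)
        have "dist (u * x) (u * v * z) = norm (u * (c - v) * z)"
          by (simp add: dist_norm c(2) algebra_simps)
        also have "\<dots> = norm (c - v) * norm z"
          by (simp add: norm_mult norm_U u)
        also have "\<dots> \<le> 2 * pi / n * r"
          using v(2) that by (intro mult_mono) auto
        also note n'
        finally have "dist (G (u * x)) (G (u * v * z)) < \<eta>"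
          using that u x \<open>norm v = 1\<close> by (intro d) (auto simp: norm_mult norm_U)
        then show "G (u * x) - \<eta> \<le> G (u * v * z)"
          by (simp add: dist_real_def)
      qed
      also have "\<dots> = (\<Sum>u\<in>U. G (u * z))"
        by (rule sum.reindex_bij_witness[where i = "\<lambda>u. u / v" and j = "\<lambda>u. u * v"])
           (auto simp: U_def power_mult_distrib power_divide v(1) \<open>v \<noteq> 0\<close>)
      finally show ?thesis
        using Sx by (simp add: sum_subtractf algebra_simps)
    qed
    have "card U * (measure lborel (cball (0::complex) r) * (ln (norm (F 0)) - \<eta>))
        = (LINT z:cball (0::complex) r|lborel. card U * (ln (norm (F 0)) - \<eta>))"
      by (simp add: set_lebesgue_integral_def)
    also have "\<dots> \<le> (LINT z:cball 0 r|lborel. (\<Sum>u\<in>U. G (u * z)))"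
    proof (rule set_integral_mono)
      show "set_integrable lborel (cball 0 r) (\<lambda>z. card U * (ln (norm (F 0)) - \<eta>))"
        unfolding set_integrable_def by (intro borel_integrable_compact) auto
      show "set_integrable lborel (cball 0 r) (\<lambda>z. \<Sum>u\<in>U. G (u * z))"
        using intG by (simp add: set_integrable_def sum_distrib_left)
    qed (rule bound)
    also have "\<dots> = (\<Sum>u\<in>U. LINT z:cball 0 r|lborel. G (u * z))"
      using intG unfolding set_lebesgue_integral_def set_integrable_def
      by (subst Bochner_Integration.integral_sum[symmetric]) (auto simp: sum_distrib_left)
    also have "\<dots> = card U * (LINT z:cball 0 r|lborel. G z)"
      by (simp add: integral_cball_rotate norm_U borel_measurable_continuous_onI contG)
    finally show ?thesis
      using \<open>card U > 0\<close> by (simp add: mult_le_cancel_left_pos)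
  qed
  have "measure lborel (cball (0::complex) r) * ln (norm (F 0)) - \<eta> \<le> (LINT z:cball 0 r|lborel. G z)" 
    if "\<eta> > 0" for \<eta>
  proof -
    define m where "m = measure lborel (cball (0::complex) r)"
    have "0 \<le> m" by (simp add: m_def)
    \<comment> \<open>The slack is \<open>\<eta> / (m + 1)\<close> rather than
      \<open>\<eta> / m\<close> because \<open>m\<close> is \<open>0\<close> when \<open>r\<close>
      is \<open>0\<close>.\<close>
    then have "m * (\<eta> / (m + 1)) \<le> \<eta>"
      using \<open>\<eta> > 0\<close> by (simp add: field_simps)
    moreover have "m * (ln (norm (F 0)) - \<eta> / (m + 1)) \<le> (LINT z:cball 0 r|lborel. G z)"
      unfolding m_def[symmetric] using \<open>0 \<le> m\<close> \<open>\<eta> > 0\<close> 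
      by (intro 1[folded m_def]) simp
    ultimately show ?thesis
      by (simp add: m_def[symmetric] right_diff_distrib)
  qed
  then show ?thesis
    unfolding G_def by (meson field_le_epsilon diff_le_eq)
qed

text \<open>Fatou's lemma removes the truncation at \<epsilon> from
  \<open>ln_max_submean_at_0\<close>. Passing to the nonnegative function
  \<open>B - ln (norm (F z))\<close> allows a statement that presupposes no integrability;
  finiteness is part of the result.\<close>

lemma nn_integral_ln_submean_at_0:
  assumes holF: "F holomorphic_on UNIV" and "F 0 \<noteq> 0" and "0 \<le> r"
    and bound: "\<And>z. norm z \<le> r \<Longrightarrow> norm (F z) \<le> exp B"
  shows "(\<integral>\<^sup>+z\<in>cball 0 r. ennreal (B - ln (norm (F z))) \<partial>lborel)
    \<le> ennreal (measure lborel (cball (0::complex) r) * (B - ln (norm (F 0))))"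
proof -
  \<comment> \<open>These levels tend to \<open>0\<close> and never exceed
    \<open>norm (F 0)\<close>, hence not \<open>exp B\<close>, so the truncated integrand
    \<open>G n\<close> is nonnegative on the disc.\<close>
  define \<epsilon> where "\<epsilon> n = norm (F 0) / Suc n" for n
  define G where "G n z = B - ln (max (norm (F z)) (\<epsilon> n))" for n z
  define g where "g n z = ennreal (G n z) * indicator (cball 0 r) z" for n z
  have \<epsilon>: "0 < \<epsilon> n" "\<epsilon> n \<le> exp B" for n
  proof -
    show "0 < \<epsilon> n" using \<open>F 0 \<noteq> 0\<close> by (simp add: \<epsilon>_def)
    have "\<epsilon> n \<le> norm (F 0)" by (simp add: \<epsilon>_def divide_le_eq mult_le_cancel_left1)
    also have "\<dots> \<le> exp B" using bound[of 0] \<open>0 \<le> r\<close> by simp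
    finally show "\<epsilon> n \<le> exp B" .
  qed
  have "\<epsilon> \<longlonglongrightarrow> 0"
    unfolding \<epsilon>_def by (rule LIMSEQ_Suc) real_asymp
  have contF: "continuous_on A F" for A
    using holF holomorphic_on_imp_continuous_on continuous_on_subset by blast
  have contG: "continuous_on A (G n)" for A n
    unfolding G_def using \<epsilon>(1)[of n] by (intro continuous_intros contF) (auto simp: max_def)
  have [measurable]: "cball (0::complex) r \<in> sets borel"
    by simp
  have [measurable]: "G n \<in> borel_measurable borel" for n
    by (intro borel_measurable_continuous_onI contG)
  have le: "(\<integral>\<^sup>+z. g n z \<partial>lborel) \<le> ennreal (measure lborel (cball (0::complex) r) * (B - ln (norm (F 0))))" for n
  proof -
    have G_nonneg: "0 \<le> G n z" if "norm z \<le> r" for z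
    proof -
      have "ln (max (norm (F z)) (\<epsilon> n)) \<le> ln (exp B)"
        using bound[OF that] \<epsilon>[of n] by (subst ln_le_cancel_iff) auto
      then show ?thesis by (simp add: G_def)
    qed
    have int: "set_integrable lborel (cball 0 r) (G n)"
      unfolding set_integrable_def by (intro borel_integrable_compact contG) simp
    have "(\<integral>\<^sup>+z. g n z \<partial>lborel) = (\<integral>\<^sup>+z. ennreal (indicator (cball 0 r) z *\<^sub>R G n z) \<partial>lborel)"
      by (intro nn_integral_cong) (simp add: g_def indicator_def)
    also have "\<dots> = ennreal (LINT z:cball 0 r|lborel. G n z)"
      unfolding set_lebesgue_integral_def
      using int G_nonneg by (intro nn_integral_eq_integral) (auto simp: set_integrable_def indicator_def)
    also have "(LINT z:cball 0 r|lborel. G n z)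
        = (LINT z:cball (0::complex) r|lborel. B) - (LINT z:cball 0 r|lborel. ln (max (norm (F z)) (\<epsilon> n)))"
      unfolding G_def
    proof (rule set_integral_diff(2))
      show "set_integrable lborel (cball 0 r) (\<lambda>z. ln (max (norm (F z)) (\<epsilon> n)))"
        unfolding set_integrable_def using \<epsilon>(1)[of n]
        by (intro borel_integrable_compact continuous_intros contF) (auto simp: max_def)
      show "set_integrable lborel (cball (0::complex) r) (\<lambda>z. B)"
        unfolding set_integrable_def by (intro borel_integrable_compact) auto
    qed
    also have "(LINT z:cball (0::complex) r|lborel. B) = measure lborel (cball (0::complex) r) * B"
      by (simp add: set_lebesgue_integral_def)
    also have "measure lborel (cball (0::complex) r) * B - (LINT z:cball 0 r|lborel. ln (max (norm (F z)) (\<epsilon> n)))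
        \<le> measure lborel (cball (0::complex) r) * (B - ln (norm (F 0)))"
      using ln_max_submean_at_0[OF holF \<open>F 0 \<noteq> 0\<close> \<epsilon>(1) \<open>0 \<le> r\<close>] by (simp add: right_diff_distrib)
    finally show ?thesis by (simp add: ennreal_leI)
  qed
  have "(\<integral>\<^sup>+z\<in>cball 0 r. ennreal (B - ln (norm (F z))) \<partial>lborel) \<le> (\<integral>\<^sup>+z. liminf (\<lambda>n. g n z) \<partial>lborel)"
  proof (intro nn_integral_mono Liminf_bounded)
    fix z
    \<comment> \<open>At a zero of \<open>F\<close> the convention \<open>ln 0 = 0\<close> makes the
      left side \<open>B\<close>; a level below \<open>1\<close> has negative logarithm, so
      \<open>G n z\<close> is at least \<open>B\<close>. Elsewhere the truncation is inactive once
      the level is below \<open>norm (F z)\<close>.\<close>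
    define \<delta> where "\<delta> = (if F z = 0 then 1 else norm (F z))"
    have "\<delta> > 0" by (simp add: \<delta>_def)
    then have "\<forall>\<^sub>F n in sequentially. \<epsilon> n < \<delta>"
      using order_tendstoD(2)[OF \<open>\<epsilon> \<longlonglongrightarrow> 0\<close>] by blast
    then show "\<forall>\<^sub>F n in sequentially. ennreal (B - ln (norm (F z))) * indicator (cball 0 r) z \<le> g n z"
    proof eventually_elim
      case (elim n)
      then have "B - ln (norm (F z)) \<le> G n z"
        using \<epsilon>(1)[of n] by (auto simp: G_def \<delta>_def max_def split: if_splits)
      then show ?case
        unfolding g_def by (intro mult_right_mono ennreal_leI) auto
    qed
  qed
  also have "\<dots> \<le> liminf (\<lambda>n. \<integral>\<^sup>+z. g n z \<partial>lborel)"
    by (intro nn_integral_liminf) (auto simp: g_def)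
  also have "\<dots> \<le> limsup (\<lambda>n. \<integral>\<^sup>+z. g n z \<partial>lborel)"
    by (simp add: Liminf_le_Limsup)
  also have "\<dots> \<le> ennreal (measure lborel (cball (0::complex) r) * (B - ln (norm (F 0))))"
    by (intro Limsup_bounded always_eventually allI le)
  finally show ?thesis .
qed

text \<open>This is the case of centre \<open>0\<close> applied to \<open>F (z + w)\<close>.\<close>

lemma nn_integral_ln_submean:
  assumes holF: "F holomorphic_on UNIV" and "F w \<noteq> 0" and "0 \<le> r"
    and bound: "\<And>z. z \<in> cball w r \<Longrightarrow> norm (F z) \<le> exp B"
  shows "(\<integral>\<^sup>+z\<in>cball w r. ennreal (B - ln (norm (F z))) \<partial>lborel)
    \<le> ennreal (measure lborel (cball w r) * (B - ln (norm (F w))))"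
proof -
  have [measurable]: "F \<in> borel_measurable borel"
    using holF by (intro borel_measurable_continuous_onI holomorphic_on_imp_continuous_on)
  have [measurable]: "cball w r \<in> sets borel"
    by simp
  have "(\<integral>\<^sup>+z\<in>cball w r. ennreal (B - ln (norm (F z))) \<partial>lborel)
      = (\<integral>\<^sup>+z. ennreal (B - ln (norm (F (z + w)))) * indicator (cball w r) (z + w) \<partial>lborel)"
    by (rule nn_integral_lborel_translation[symmetric]) measurable
  also have "\<dots> = (\<integral>\<^sup>+z\<in>cball 0 r. ennreal (B - ln (norm (F (z + w)))) \<partial>lborel)"
    by (intro nn_integral_cong) (simp add: indicator_def dist_norm)
  also have "\<dots> \<le> ennreal (measure lborel (cball (0::complex) r) * (B - ln (norm (F (0 + w)))))"
    using assms(2,3)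
    by (intro nn_integral_ln_submean_at_0 holomorphic_on_compose_gen[OF _ holF, unfolded o_def] holomorphic_intros bound)
       (auto simp: dist_norm)
  finally show ?thesis
    using \<open>0 \<le> r\<close> by (simp add: content_cball)
qed

section \<open>Growth of solutions of the pantograph equation\<close>

text \<open>The growth estimates need no more of the series than its functional equation with
  unimodular constants and its normalization at \<open>0\<close>. The irrationality of \<alpha>
  enters through \<open>orbit_dense\<close>.\<close>

locale pantograph =
  fixes f :: "complex \<Rightarrow> complex" and c q :: complex
  assumes holomorphic: "f holomorphic_on UNIV"
    and deriv_f: "\<And>z. deriv f z = c * f (q * z)"
    and norm_c: "norm c = 1" and norm_q: "norm q = 1" and norm_f_0: "norm (f 0) = 1"
    and orbit_dense: "\<And>u e. norm u = 1 \<Longrightarrow> 0 < e \<Longrightarrow> \<exists>k. norm (q ^ k - u) < e"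
begin

lemma continuous: "continuous_on A f"
  using holomorphic holomorphic_on_imp_continuous_on continuous_on_subset by blast

lemma holomorphic': "f holomorphic_on A"
  using holomorphic holomorphic_on_subset by blast

lemma q_nonzero: "q \<noteq> 0"
  using norm_q by auto

text \<open>By the chain rule, differentiating \<open>f (q ^ k * z)\<close> yields the unimodular
  factor \<open>q ^ k * c\<close> and raises the exponent of \<open>q\<close> by one. The induction
  carries an identity of functions with a constant \<open>a\<close>, as moduli alone cannot be
  differentiated.\<close>

lemma norm_higher_deriv: "norm ((deriv ^^ k) f z) = norm (f (q ^ k * z))"
proof -
  have "\<exists>a. norm a = 1 \<and> (\<forall>z. (deriv ^^ k) f z = a * f (q ^ k * z))"
  proof (induction k)
    case (Suc k)
    then obtain a where a: "norm a = 1" "(deriv ^^ k) f = (\<lambda>z. a * f (q ^ k * z))"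
      by auto
    have "(deriv ^^ Suc k) f z = (a * q ^ k * c) * f (q ^ Suc k * z)" for z
    proof -
      have "(f has_field_derivative deriv f (q ^ k * z)) (at (q ^ k * z))"
        using holomorphic by (simp add: holomorphic_derivI)
      then have "((\<lambda>z. f (q ^ k * z)) has_field_derivative deriv f (q ^ k * z) * q ^ k) (at z)"
        by (rule DERIV_chain2) (auto intro!: derivative_eq_intros)
      then have "((\<lambda>z. a * f (q ^ k * z)) has_field_derivative a * (deriv f (q ^ k * z) * q ^ k)) (at z)"
        by (rule DERIV_cmult)
      then have "deriv (\<lambda>z. a * f (q ^ k * z)) z = a * (deriv f (q ^ k * z) * q ^ k)"
        by (rule DERIV_imp_deriv)
      then show ?thesis
        by (simp add: a(2) deriv_f mult_ac)
    qed
    moreover have "norm (a * q ^ k * c) = 1"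
      by (simp add: norm_mult norm_power a norm_c norm_q)
    ultimately show ?case by blast
  qed (auto intro: exI[of _ 1])
  then show ?thesis by (auto simp: norm_mult)
qed

text \<open>All derivatives at \<open>0\<close> have modulus \<open>1\<close>, so the Taylor series
  is dominated termwise by the exponential series.\<close>

lemma norm_le_exp: "norm (f z) \<le> exp (norm z)"
proof -
  have "(\<lambda>n. (deriv ^^ n) f 0 / fact n * (z - 0) ^ n) sums f z"
    by (rule holomorphic_power_series[of _ _ "norm z + 1"]) (auto intro: holomorphic')
  moreover have "(\<lambda>n. norm z ^ n / fact n) sums exp (norm z)"
    using exp_converges[of "norm z"] by (simp add: divide_inverse mult.commute scaleR_conv_of_real)
  ultimately show ?thesis
    by (rule norm_sums_le)
       (simp add: norm_mult norm_divide norm_power norm_higher_deriv norm_f_0)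
qed

text \<open>Cauchy's inequality bounds every \<open>R ^ n / fact n\<close> by the maximum of the
  modulus on the circle. Weighting these bounds with \<open>((R - 1) / R) ^ n\<close> and summing
  gives \<open>exp (R - 1)\<close> on the left and \<open>R\<close> times the maximum on the
  right.\<close>

lemma large_on_sphere:
  assumes "R > 1"
  obtains z where "norm z = R" "exp (R - 1) / R \<le> norm (f z)"
proof -
  have "\<exists>x\<in>sphere 0 R. \<forall>y\<in>sphere 0 R. norm (f y) \<le> norm (f x)"
    using assms by (intro continuous_attains_sup continuous_intros continuous) auto
  then obtain x where x: "norm x = R" and max: "\<And>y. norm y = R \<Longrightarrow> norm (f y) \<le> norm (f x)"
    by auto
  have "norm ((deriv ^^ n) f 0) \<le> fact n * norm (f x) / R ^ n" for n
    using assms by (intro Cauchy_inequality holomorphic' continuous max) auto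
  then have "R ^ n / fact n \<le> norm (f x)" for n
    using assms by (simp add: norm_higher_deriv norm_f_0 field_simps)
  then have "((R - 1) / R) ^ n * (R ^ n / fact n) \<le> ((R - 1) / R) ^ n * norm (f x)" for n
    using assms by (intro mult_left_mono) auto
  moreover have "((R - 1) / R) ^ n * (R ^ n / fact n) = (R - 1) ^ n / fact n" for n
    using assms by (simp add: power_divide)
  ultimately have "(R - 1) ^ n / fact n \<le> ((R - 1) / R) ^ n * norm (f x)" for n
    by metis
  moreover have "(\<lambda>n. (R - 1) ^ n / fact n) sums exp (R - 1)"
    using exp_converges[of "R - 1"] by (simp add: divide_inverse mult.commute scaleR_conv_of_real)
  moreover have "(\<lambda>n. ((R - 1) / R) ^ n * norm (f x)) sums (1 / (1 - (R - 1) / R) * norm (f x))"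
    using assms by (intro sums_mult2 geometric_sums) simp
  ultimately have "exp (R - 1) \<le> 1 / (1 - (R - 1) / R) * norm (f x)"
    by (rule sums_le)
  also have "1 / (1 - (R - 1) / R) = R"
    using assms by (simp add: field_simps)
  finally show ?thesis
    using x assms that[of x] by (simp add: field_simps)
qed

text \<open>Compactness of the circle gives one bound \<open>K\<close> for all \<open>u\<close>,
  which later bounds the factorials in Cauchy's inequality.\<close>

lemma orbit_uniformly_dense:
  assumes "e > 0"
  obtains K where "\<And>u. norm u = 1 \<Longrightarrow> \<exists>k\<le>K. norm (q ^ k - u) < e"
proof -
  have "sphere 0 1 \<subseteq> (\<Union>k\<in>UNIV. ball (q ^ k) e)"
    using orbit_dense[OF _ assms] by (auto simp: dist_norm)
  then obtain C where "finite C" and C: "sphere 0 1 \<subseteq> (\<Union>k\<in>C. ball (q ^ k) e)"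
    by (rule compactE_image[OF compact_sphere, rotated]) auto
  have "\<exists>k\<le>Max C. norm (q ^ k - u) < e" if "norm u = 1" for u
  proof -
    obtain k where "k \<in> C" "norm (q ^ k - u) < e"
      using C \<open>norm u = 1\<close> by (force simp: dist_norm)
    then show ?thesis using \<open>finite C\<close> by (intro exI[of _ k]) auto
  qed
  then show ?thesis by (rule that)
qed

text \<open>A large value \<open>\<bar>f z\<^sub>0\<bar>\<close> is also the modulus of \<open>f\<^sup>(\<^sup>k\<^sup>)\<close> at \<open>z\<^sub>0 / q\<^sup>k\<close>, so by Cauchy's inequality \<open>f\<close> is
  large somewhere near \<open>z\<^sub>0 / q\<^sup>k\<close>, and boundedly many \<open>k\<close> suffice to come close to every point of
  the circle.\<close>

lemma large_nearby:
  assumes "\<delta> > 0"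
  shows "\<forall>\<^sub>F t in at_top. \<forall>z. norm z \<le> R \<longrightarrow>
    (\<exists>w. norm (w - z) \<le> \<delta> \<and> f (of_real t * w) \<noteq> 0 \<and>
         norm w - ln (norm (f (of_real t * w))) / t \<le> \<delta>)"
proof (cases "R > 0")
  \<comment> \<open>Here \<open>z\<close> can only be \<open>0\<close>, and \<open>w = 0\<close>
    serves because \<open>norm (f 0) = 1\<close> has logarithm \<open>0\<close>. The same
    \<open>w\<close> serves below whenever \<open>norm z \<le> \<delta>\<close>.\<close>
  case False
  then show ?thesis
    using assms norm_f_0 by (intro always_eventually allI impI exI[of _ 0]) auto
next
  case True
  then have "\<delta> / (2 * R) > 0" using assms by simp
  \<comment> \<open>A rotation error of \<open>\<delta> / (2 * R)\<close> costs half of the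
    permitted distance \<open>t * \<delta>\<close>; the other half covers the step of length
    \<open>1\<close> in Cauchy's inequality.\<close>
  then obtain K where K: "\<And>u. norm u = 1 \<Longrightarrow> \<exists>k\<le>K. norm (q ^ k - u) < \<delta> / (2 * R)"
    using orbit_uniformly_dense by blast
  define L :: real where "L = ln (fact K)"
  \<comment> \<open>The numerator collects the losses: \<open>1\<close> and
    \<open>ln s \<le> ln (t * R)\<close> from \<open>large_on_sphere\<close>, \<open>L\<close> from
    the factorial in Cauchy's inequality, and another \<open>1\<close> since \<open>norm x\<close>
    may exceed \<open>s\<close> by \<open>1\<close>.\<close>
  have "((\<lambda>t. (2 + ln (t * R) + L) / t) \<longlongrightarrow> 0) at_top"
    using True by real_asymp
  then have "\<forall>\<^sub>F t in at_top. (2 + ln (t * R) + L) / t < \<delta>"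
    using assms by (rule order_tendstoD(2))
  then show ?thesis
    using eventually_gt_at_top[of "2 / \<delta>"]
  proof eventually_elim
    case (elim t)
    have "t > 0" using elim(2) assms by (metis divide_pos_pos less_trans zero_less_numeral)
    have t: "1 / t \<le> \<delta> / 2" using elim(2) assms \<open>t > 0\<close> by (simp add: field_simps)
    show ?case
    proof (intro allI impI)
      fix z :: complex
      assume z: "norm z \<le> R"
      show "\<exists>w. norm (w - z) \<le> \<delta> \<and> f (of_real t * w) \<noteq> 0 \<and>
          norm w - ln (norm (f (of_real t * w))) / t \<le> \<delta>"
      proof (cases "norm z \<le> \<delta>")
        case True
        then show ?thesis
          using assms norm_f_0 by (intro exI[of _ 0]) auto
      next
        case False
        define s where "s = t * norm z"
        have "1 < t * \<delta>" using t assms \<open>t > 0\<close> by (simp add: field_simps)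
        also have "\<dots> \<le> s" using False \<open>t > 0\<close> by (simp add: s_def)
        finally have "s > 1" .
        then obtain z0 where z0: "norm z0 = s" "exp (s - 1) / s \<le> norm (f z0)"
          by (rule large_on_sphere)
        have "z \<noteq> 0" using False assms by auto
        have "norm (z0 / (of_real t * z)) = 1"
          using \<open>t > 0\<close> \<open>z \<noteq> 0\<close> by (simp add: norm_divide norm_mult z0 s_def)
        then obtain k where k: "k \<le> K" "norm (q ^ k - z0 / (of_real t * z)) < \<delta> / (2 * R)"
          using K by blast
        define y where "y = z0 / q ^ k"
        have "\<exists>x\<in>sphere y 1. \<forall>x'\<in>sphere y 1. norm (f x') \<le> norm (f x)"
          by (intro continuous_attains_sup continuous_intros continuous) auto
        then obtain x where x: "norm (y - x) = 1"
          and max: "\<And>x'. norm (y - x') = 1 \<Longrightarrow> norm (f x') \<le> norm (f x)"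
          by (auto simp: dist_norm)
        \<comment> \<open>On a circle of radius \<open>1\<close> only the factorial is lost, and
          \<open>k \<le> K\<close> makes this loss independent of \<open>t\<close> and
          \<open>z\<close>.\<close>
        have "norm ((deriv ^^ k) f y) \<le> fact k * norm (f x) / 1 ^ k"
          by (intro Cauchy_inequality holomorphic' continuous max) auto
        also have "\<dots> \<le> fact K * norm (f x)"
          using k(1) by (simp add: fact_mono mult_right_mono)
        finally have "norm (f z0) \<le> fact K * norm (f x)"
          by (simp add: norm_higher_deriv y_def q_nonzero)
        with z0(2) have fx: "exp (s - 1) / s \<le> fact K * norm (f x)"
          by linarith
        moreover have "0 < exp (s - 1) / s"
          using \<open>s > 1\<close> by simp
        ultimately have "f x \<noteq> 0" by auto
        have "ln (exp (s - 1) / s) \<le> ln (fact K * norm (f x))"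
          using fx \<open>s > 1\<close> \<open>f x \<noteq> 0\<close> by (subst ln_le_cancel_iff) auto
        then have ln_fx: "s - 1 - ln s \<le> L + ln (norm (f x))"
          using \<open>s > 1\<close> \<open>f x \<noteq> 0\<close> by (simp add: ln_div ln_mult L_def)
        define w where "w = x / of_real t"
        have tw: "of_real t * w = x" using \<open>t > 0\<close> by (simp add: w_def)
        have "norm (y - of_real t * z) = norm ((of_real t * z) * (q ^ k - z0 / (of_real t * z)))"
        proof -
          have "norm (y - of_real t * z) = norm (q ^ k * (y - of_real t * z))"
            by (simp add: norm_mult norm_power norm_q)
          also have "q ^ k * (y - of_real t * z) = - ((of_real t * z) * (q ^ k - z0 / (of_real t * z)))"
            using \<open>t > 0\<close> \<open>z \<noteq> 0\<close> q_nonzero by (simp add: y_def field_simps)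
          finally show ?thesis by (simp only: norm_minus_cancel)
        qed
        also have "\<dots> \<le> (t * R) * (\<delta> / (2 * R))"
          using k(2) z \<open>t > 0\<close> \<open>R > 0\<close> unfolding norm_mult by (intro mult_mono) auto
        also have "\<dots> = t * \<delta> / 2" using \<open>R > 0\<close> by simp
        finally have y: "norm (y - of_real t * z) \<le> t * \<delta> / 2" .
        have "norm (x - of_real t * z) \<le> norm (y - of_real t * z) + norm (y - x)"
          by (metis add.commute diff_add_cancel norm_minus_commute norm_triangle_ineq norm_triangle_sub add_diff_eq norm_diff_triangle_le order_refl)
        also have "\<dots> \<le> t * \<delta>"
          using y x t \<open>t > 0\<close> by (simp add: field_simps)
        finally have "norm (of_real t * (w - z)) \<le> t * \<delta>"
          by (simp add: right_diff_distrib tw)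
        then have wz: "norm (w - z) \<le> \<delta>"
          using \<open>t > 0\<close> by (simp add: norm_mult)
        have "norm x \<le> norm y + 1"
          using norm_triangle_ineq4[of y "y - x"] x by simp
        then have "norm x \<le> s + 1"
          by (simp add: y_def norm_divide norm_power norm_q z0)
        moreover have "ln s \<le> ln (t * R)"
          using \<open>s > 1\<close> z \<open>t > 0\<close> \<open>R > 0\<close> unfolding s_def by (intro ln_mono mult_left_mono) auto
        ultimately have "norm x - ln (norm (f x)) \<le> 2 + ln (t * R) + L"
          using ln_fx by linarith
        then have "(norm x - ln (norm (f x))) / t \<le> (2 + ln (t * R) + L) / t"
          using \<open>t > 0\<close> by (intro divide_right_mono) auto
        also have "\<dots> < \<delta>" by fact
        finally have "norm w - ln (norm (f x)) / t \<le> \<delta>"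
          using \<open>t > 0\<close> by (simp add: w_def norm_divide diff_divide_distrib)
        with wz \<open>f x \<noteq> 0\<close> show ?thesis
          by (intro exI[of _ w]) (simp add: tw)
      qed
    qed
  qed
qed

end

section \<open>Convergence to the maximal growth in the mean on discs\<close>

lemma emeasure_cball_complex:
  "0 \<le> r \<Longrightarrow> emeasure lborel (cball (z::complex) r) = ennreal (pi * r\<^sup>2)"
  by (simp add: emeasure_cball unit_ball_vol_2)

lemma measure_cball_complex: "0 \<le> r \<Longrightarrow> measure lborel (cball (z::complex) r) = pi * r\<^sup>2"
  by (simp add: content_cball unit_ball_vol_2)

context pantograph
begin

text \<open>By \<open>ln 0 = 0\<close> the value where \<open>f (of_real t * z)\<close> vanishes is
  \<open>norm z\<close>, so the function is real-valued and, for positive \<open>t\<close>,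
  nonnegative everywhere.\<close>

definition deficit :: "real \<Rightarrow> complex \<Rightarrow> real" where
  "deficit t z = norm z - ln (norm (f (of_real t * z))) / t"

lemma ln_norm_le: "ln (norm (f z)) \<le> norm z"
proof (cases "f z = 0")
  case False
  then have "ln (norm (f z)) \<le> ln (exp (norm z))"
    using norm_le_exp by (subst ln_le_cancel_iff) auto
  then show ?thesis by simp
qed auto

lemma deficit_nonneg: "t > 0 \<Longrightarrow> 0 \<le> deficit t z"
  using ln_norm_le[of "of_real t * z"] by (simp add: deficit_def field_simps norm_mult)

lemma f_measurable [measurable]: "f \<in> borel_measurable borel"
  by (intro borel_measurable_continuous_onI continuous)

lemma deficit_measurable [measurable]: "deficit t \<in> borel_measurable borel"
  unfolding deficit_def[abs_def] by measurable

text \<open>On the disc \<open>t * norm z\<close> is at most \<open>B = t * (norm w + r)\<close>.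
  The sub-mean value inequality with this \<open>B\<close>, divided by \<open>t\<close>, gives the
  bound; the summand \<open>r\<close> is the price of replacing \<open>norm z\<close> by a
  constant.\<close>

lemma nn_integral_deficit_le:
  assumes "t > 0" "r \<ge> 0" "f (of_real t * w) \<noteq> 0"
  shows "(\<integral>\<^sup>+z\<in>cball w r. ennreal (deficit t z) \<partial>lborel) \<le> ennreal (pi * r\<^sup>2 * (deficit t w + r))"
proof -
  define B where "B = t * (norm w + r)"
  have [measurable]: "cball w r \<in> sets borel" by simp
  have B: "t * norm z \<le> B" if "z \<in> cball w r" for z
  proof -
    have "norm z \<le> norm w + norm (w - z)"
      by (metis norm_triangle_sub norm_minus_commute)
    then show ?thesis
      using that \<open>t > 0\<close> by (simp add: B_def dist_norm)
  qed
  have holo: "(\<lambda>z. f (of_real t * z)) holomorphic_on UNIV"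
    by (intro holomorphic_on_compose_gen[OF _ holomorphic, unfolded o_def] holomorphic_intros) auto
  have "(\<integral>\<^sup>+z\<in>cball w r. ennreal (deficit t z) \<partial>lborel)
      \<le> (\<integral>\<^sup>+z. ennreal (1 / t) * (ennreal (B - ln (norm (f (of_real t * z)))) * indicator (cball w r) z) \<partial>lborel)"
  proof (intro nn_integral_mono)
    fix z
    show "ennreal (deficit t z) * indicator (cball w r) z
      \<le> ennreal (1 / t) * (ennreal (B - ln (norm (f (of_real t * z)))) * indicator (cball w r) z)"
    proof (cases "z \<in> cball w r")
      case True
      have "deficit t z \<le> 1 / t * (B - ln (norm (f (of_real t * z))))"
        using B[OF True] \<open>t > 0\<close> by (simp add: deficit_def field_simps)
      then have "ennreal (deficit t z) \<le> ennreal (1 / t * (B - ln (norm (f (of_real t * z)))))"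
        by (rule ennreal_leI)
      then show ?thesis
        using True \<open>t > 0\<close> by (simp add: ennreal_mult'[of "1 / t", symmetric])
    qed simp
  qed
  also have "\<dots> = ennreal (1 / t) * (\<integral>\<^sup>+z\<in>cball w r. ennreal (B - ln (norm (f (of_real t * z)))) \<partial>lborel)"
    by (rule nn_integral_cmult) measurable
  also have "\<dots> \<le> ennreal (1 / t) * ennreal (measure lborel (cball w r) * (B - ln (norm (f (of_real t * w)))))"
  proof (intro mult_left_mono nn_integral_ln_submean holo assms)
    fix z assume "z \<in> cball w r"
    have "norm (f (of_real t * z)) \<le> exp (t * norm z)"
      using norm_le_exp[of "of_real t * z"] \<open>t > 0\<close> by (simp add: norm_mult)
    also have "\<dots> \<le> exp B" using B[OF \<open>z \<in> cball w r\<close>] by simp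
    finally show "norm (f (of_real t * z)) \<le> exp B" .
  qed auto
  also have "\<dots> = ennreal (1 / t * (measure lborel (cball w r) * (B - ln (norm (f (of_real t * w))))))"
    using \<open>t > 0\<close> by (intro ennreal_mult'[symmetric]) simp
  also have "1 / t * (measure lborel (cball w r) * (B - ln (norm (f (of_real t * w)))))
      = pi * r\<^sup>2 * (deficit t w + r)"
    using \<open>t > 0\<close> \<open>r \<ge> 0\<close> by (simp add: measure_cball_complex B_def deficit_def field_simps)
  finally show ?thesis .
qed

text \<open>The bound on discs applies with centre \<open>0\<close>, where \<open>f\<close> does not
  vanish.\<close>

lemma integrable_deficit:
  assumes "t > 0"
  shows "set_integrable lborel (cball 0 R) (deficit t)"
proof (cases "R \<ge> 0")
  case True
  have [measurable]: "cball (0::complex) R \<in> sets borel" by simp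
  have "(\<integral>\<^sup>+z. ennreal (indicator (cball 0 R) z *\<^sub>R deficit t z) \<partial>lborel)
      = (\<integral>\<^sup>+z\<in>cball 0 R. ennreal (deficit t z) \<partial>lborel)"
    by (intro nn_integral_cong) (simp add: indicator_def)
  also have "\<dots> < \<infinity>"
  proof -
    have "f (of_real t * 0) \<noteq> 0" using norm_f_0 by auto
    then show ?thesis
      using nn_integral_deficit_le[of t R 0] assms True le_less_trans by fastforce
  qed
  finally show ?thesis
    unfolding set_integrable_def using assms
    by (intro integrableI_nonneg) (auto simp: deficit_nonneg)
qed (simp add: set_integrable_def)

text \<open>Averaging over all centres \<open>y\<close> replaces a covering of \<open>cball 0 R\<close> by discs of radius \<open>\<delta>\<close>.\<close>

lemma nn_integral_deficit_small:
  assumes "\<delta> > 0" "R \<ge> 0" "t > 0"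
    and near: "\<And>z. norm z \<le> R + \<delta> \<Longrightarrow>
      \<exists>w. norm (w - z) \<le> \<delta> \<and> f (of_real t * w) \<noteq> 0 \<and> deficit t w \<le> \<delta>"
  shows "(\<integral>\<^sup>+z\<in>cball 0 R. ennreal (deficit t z) \<partial>lborel) \<le> ennreal (12 * \<delta> * pi * (R + \<delta>)\<^sup>2)"
proof -
  define V where "V z = ennreal (deficit t z)" for z
  have [measurable]: "V \<in> borel_measurable borel" unfolding V_def[abs_def] by measurable
  \<comment> \<open>This is the integral of \<open>V\<close> over the disc of radius \<delta> about
    \<open>y\<close>, with the indicator written as a jointly measurable function of
    \<open>y\<close> and \<open>z\<close> for Fubini's theorem.\<close>
  define A where "A y = (\<integral>\<^sup>+z. V z * indicator {..\<delta>} (dist y z) \<partial>lborel)" for y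
  have [measurable]: "cball (0::complex) (R + \<delta>) \<in> sets borel" "cball (0::complex) R \<in> sets borel" by simp_all
  have A_le: "A y \<le> ennreal (12 * pi * \<delta> ^ 3)" if "norm y \<le> R + \<delta>" for y
  proof -
    obtain w where w: "norm (w - y) \<le> \<delta>" "f (of_real t * w) \<noteq> 0" "deficit t w \<le> \<delta>"
      using near[OF \<open>norm y \<le> R + \<delta>\<close>] by blast
    \<comment> \<open>The sub-mean value inequality needs a centre with small deficit, so the disc
      about \<open>y\<close> is enlarged to one of twice the radius about \<open>w\<close>.\<close>
    have "A y \<le> (\<integral>\<^sup>+z\<in>cball w (2 * \<delta>). V z \<partial>lborel)"
      unfolding A_def
    proof (intro nn_integral_mono mult_left_mono)
      fix z
      show "indicator {..\<delta>} (dist y z) \<le> (indicator (cball w (2 * \<delta>)) z :: ennreal)"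
        using w(1) dist_triangle[of w z y] by (auto simp: indicator_def dist_norm)
    qed auto
    also have "\<dots> \<le> ennreal (pi * (2 * \<delta>)\<^sup>2 * (deficit t w + 2 * \<delta>))"
      unfolding V_def using assms w(2) by (intro nn_integral_deficit_le) auto
    also have "\<dots> \<le> ennreal (pi * (2 * \<delta>)\<^sup>2 * (3 * \<delta>))"
      using w(3) by (intro ennreal_leI mult_left_mono) auto
    also have "pi * (2 * \<delta>)\<^sup>2 * (3 * \<delta>) = 12 * pi * \<delta> ^ 3"
      by (simp add: power2_eq_square power3_eq_cube)
    finally show ?thesis .
  qed
  have "(\<integral>\<^sup>+z\<in>cball 0 R. V z \<partial>lborel) * ennreal (pi * \<delta>\<^sup>2)
      = (\<integral>\<^sup>+z. V z * indicator (cball 0 R) z * ennreal (pi * \<delta>\<^sup>2) \<partial>lborel)"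
    by (rule nn_integral_multc[symmetric]) measurable
  \<comment> \<open>For \<open>z\<close> in \<open>cball 0 R\<close> all centres \<open>y\<close>
    within \<delta> of \<open>z\<close> lie in \<open>cball 0 (R + \<delta>)\<close>, so integration
    over \<open>y\<close> produces the full area \<open>pi * \<delta>\<^sup>2\<close>.\<close>
  also have "\<dots> \<le> (\<integral>\<^sup>+z. (\<integral>\<^sup>+y. V z * indicator {..\<delta>} (dist y z) * indicator (cball 0 (R + \<delta>)) y \<partial>lborel) \<partial>lborel)"
  proof (intro nn_integral_mono)
    fix z
    show "V z * indicator (cball 0 R) z * ennreal (pi * \<delta>\<^sup>2)
      \<le> (\<integral>\<^sup>+y. V z * indicator {..\<delta>} (dist y z) * indicator (cball 0 (R + \<delta>)) y \<partial>lborel)"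
    proof (cases "z \<in> cball 0 R")
      case True
      have [measurable]: "cball z \<delta> \<in> sets borel" by simp
      have "norm y \<le> R + \<delta>" if "dist y z \<le> \<delta>" for y
        using True that dist_triangle[of 0 y z] by (simp add: dist_commute)
      then have "(\<integral>\<^sup>+y. V z * indicator {..\<delta>} (dist y z) * indicator (cball 0 (R + \<delta>)) y \<partial>lborel)
          = (\<integral>\<^sup>+y. V z * indicator (cball z \<delta>) y \<partial>lborel)"
        by (intro nn_integral_cong) (auto simp: indicator_def dist_commute)
      also have "\<dots> = V z * ennreal (pi * \<delta>\<^sup>2)"
        using \<open>\<delta> > 0\<close> by (simp add: nn_integral_cmult emeasure_cball_complex)
      finally show ?thesis using True by simp
    qed simp
  qed
  also have "\<dots> = (\<integral>\<^sup>+y. (\<integral>\<^sup>+z. V z * indicator {..\<delta>} (dist y z) * indicator (cball 0 (R + \<delta>)) y \<partial>lborel) \<partial>lborel)"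
    by (rule lborel_pair.Fubini') measurable
  also have "\<dots> = (\<integral>\<^sup>+y\<in>cball 0 (R + \<delta>). A y \<partial>lborel)"
    unfolding A_def by (intro nn_integral_cong nn_integral_multc) measurable
  also have "\<dots> \<le> (\<integral>\<^sup>+y\<in>cball (0::complex) (R + \<delta>). ennreal (12 * pi * \<delta> ^ 3) \<partial>lborel)"
    by (intro nn_integral_mono) (auto simp: indicator_def A_le)
  also have "\<dots> = ennreal (12 * pi * \<delta> ^ 3) * ennreal (pi * (R + \<delta>)\<^sup>2)"
    using assms by (simp add: nn_integral_cmult emeasure_cball_complex)
  also have "\<dots> = ennreal (12 * \<delta> * pi * (R + \<delta>)\<^sup>2) * ennreal (pi * \<delta>\<^sup>2)"
    using assms by (simp add: power2_eq_square power3_eq_cube mult_ac flip: ennreal_mult)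
  finally show ?thesis
    using assms by (simp add: V_def ennreal_mult_le_mult_iff mult.commute[of _ "ennreal (pi * \<delta>\<^sup>2)"])
qed

text \<open>By \<open>large_nearby\<close>, the hypothesis of
  \<open>nn_integral_deficit_small\<close> holds for all large \<open>t\<close>, with \<delta> as
  small as desired.\<close>

lemma integral_deficit_tendsto_0:
  assumes "R \<ge> 0"
  shows "((\<lambda>t. LINT z:cball 0 R|lborel. deficit t z) \<longlongrightarrow> 0) at_top"
proof (rule tendstoI)
  fix e :: real
  assume "e > 0"
  \<comment> \<open>As \<delta> is at most \<open>1\<close>, \<open>R + \<delta>\<close> is at most
    \<open>R + 1\<close>, and the second entry makes the bound at most \<open>e / 2\<close>.\<close>
  define \<delta> where "\<delta> = min 1 (e / (24 * pi * (R + 1)\<^sup>2))"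
  have "\<delta> > 0" using \<open>e > 0\<close> \<open>R \<ge> 0\<close> by (simp add: \<delta>_def)
  have "12 * \<delta> * pi * (R + \<delta>)\<^sup>2 \<le> 12 * (e / (24 * pi * (R + 1)\<^sup>2)) * pi * (R + 1)\<^sup>2"
    using \<open>\<delta> > 0\<close> \<open>R \<ge> 0\<close> \<open>e > 0\<close>
    by (intro mult_mono power_mono mult_left_mono) (auto simp: \<delta>_def)
  also have "\<dots> = e / 2"
    using \<open>R \<ge> 0\<close> by (simp add: field_simps)
  finally have \<delta>: "12 * \<delta> * pi * (R + \<delta>)\<^sup>2 \<le> e / 2" .
  show "\<forall>\<^sub>F t in at_top. dist (LINT z:cball 0 R|lborel. deficit t z) 0 < e"
    using eventually_gt_at_top[of 0] large_nearby[OF \<open>\<delta> > 0\<close>, of "R + \<delta>"]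
  proof eventually_elim
    case (elim t)
    have "ennreal (LINT z:cball 0 R|lborel. deficit t z)
        = (\<integral>\<^sup>+z. ennreal (indicator (cball 0 R) z *\<^sub>R deficit t z) \<partial>lborel)"
      unfolding set_lebesgue_integral_def using integrable_deficit[OF elim(1), of R]
      by (intro nn_integral_eq_integral[symmetric])
         (auto simp: set_integrable_def deficit_nonneg elim(1))
    also have "\<dots> = (\<integral>\<^sup>+z\<in>cball 0 R. ennreal (deficit t z) \<partial>lborel)"
      by (intro nn_integral_cong) (simp add: indicator_def)
    also have "\<dots> \<le> ennreal (12 * \<delta> * pi * (R + \<delta>)\<^sup>2)"
      using \<open>\<delta> > 0\<close> \<open>R \<ge> 0\<close> elim
      by (intro nn_integral_deficit_small) (auto simp: deficit_def)
    also have "\<dots> \<le> ennreal (e / 2)"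
      by (intro ennreal_leI \<delta>)
    finally have "(LINT z:cball 0 R|lborel. deficit t z) \<le> e / 2"
      using \<open>e > 0\<close> by (simp add: ennreal_le_iff)
    moreover have "0 \<le> (LINT z:cball 0 R|lborel. deficit t z)"
      unfolding set_lebesgue_integral_def using elim(1)
      by (intro integral_nonneg_AE) (auto simp: deficit_nonneg)
    ultimately show ?case
      using \<open>e > 0\<close> by simp
  qed
qed


section \<open>Order and type\<close>

lemma max_modulus_bounds:
  assumes "r > 1"
  shows "exp (r - 1) / r \<le> max_modulus f r" "max_modulus f r \<le> exp r"
proof -
  have le: "norm (f z) \<le> exp r" if "z \<in> sphere 0 r" for z
    using norm_le_exp[of z] that by simp
  obtain z where z: "norm z = r" "exp (r - 1) / r \<le> norm (f z)"
    using large_on_sphere[OF assms] .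
  then have "z \<in> sphere 0 r" by simp
  have "norm (f z) \<le> max_modulus f r"
    unfolding max_modulus_def using le \<open>z \<in> sphere 0 r\<close>
    by (intro cSUP_upper bdd_aboveI2) auto
  with z show "exp (r - 1) / r \<le> max_modulus f r" by simp
  show "max_modulus f r \<le> exp r"
    unfolding max_modulus_def using le \<open>z \<in> sphere 0 r\<close> by (intro cSUP_least) auto
qed

lemma ln_max_modulus_bounds:
  assumes "r > 1"
  shows "r - 1 - ln r \<le> ln (max_modulus f r)" "ln (max_modulus f r) \<le> r"
proof -
  note b = max_modulus_bounds[OF assms]
  have *: "0 < exp (r - 1) / r" using assms by simp
  then have "ln (exp (r - 1) / r) \<le> ln (max_modulus f r)"
    using b by (intro ln_mono) auto
  then show "r - 1 - ln r \<le> ln (max_modulus f r)"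
    using assms by (simp add: ln_div)
  have "ln (max_modulus f r) \<le> ln (exp r)"
    using b * by (intro ln_mono) auto
  then show "ln (max_modulus f r) \<le> r" by simp
qed

lemma has_growth_order_1: "has_growth_order f 1"
proof -
  \<comment> \<open>The outer logarithm is monotone on positive arguments only.\<close>
  have pos: "\<forall>\<^sub>F r :: real in at_top. 0 < r - 1 - ln r"
    by real_asymp
  have "((\<lambda>r. ln (ln (max_modulus f r)) / ln r) \<longlongrightarrow> 1) at_top"
  proof (rule tendsto_sandwich)
    show "\<forall>\<^sub>F r in at_top. ln (r - 1 - ln r) / ln r \<le> ln (ln (max_modulus f r)) / ln r"
      using pos eventually_gt_at_top[of 1]
      by eventually_elim
        (auto intro!: divide_right_mono ln_mono dest: ln_max_modulus_bounds)
    show "\<forall>\<^sub>F r in at_top. ln (ln (max_modulus f r)) / ln r \<le> ln r / ln r"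
      using pos eventually_gt_at_top[of 1]
    proof eventually_elim
      case (elim r)
      then show ?case
        using ln_max_modulus_bounds[of r] by (intro divide_right_mono ln_mono) auto
    qed
  qed real_asymp+
  then have "((\<lambda>r. ereal (ln (ln (max_modulus f r)) / ln r)) \<longlongrightarrow> ereal 1) at_top"
    by simp
  then show ?thesis
    unfolding has_growth_order_def by (rule lim_imp_Limsup[rotated]) simp
qed

lemma growth_type_1: "growth_type 1 f = 1"
proof -
  have "((\<lambda>r. r powr (-1) * ln (max_modulus f r)) \<longlongrightarrow> 1) at_top"
  proof (rule tendsto_sandwich)
    show "\<forall>\<^sub>F r in at_top. r powr (-1) * (r - 1 - ln r) \<le> r powr (-1) * ln (max_modulus f r)"
      using eventually_gt_at_top[of 1]
      by eventually_elim (intro mult_left_mono ln_max_modulus_bounds, auto)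
    show "\<forall>\<^sub>F r in at_top. r powr (-1) * ln (max_modulus f r) \<le> r powr (-1) * r"
      using eventually_gt_at_top[of 1]
      by eventually_elim (intro mult_left_mono ln_max_modulus_bounds, auto)
  qed real_asymp+
  then have "((\<lambda>r. ereal (r powr (-1) * ln (max_modulus f r))) \<longlongrightarrow> ereal 1) at_top"
    by simp
  then show ?thesis
    unfolding growth_type_def one_ereal_def by (rule lim_imp_Limsup[rotated]) simp
qed

section \<open>The indicator\<close>

text \<open>On the square \<open>\<bar>s\<bar> \<le> \<epsilon>\<close>, \<open>0 \<le> y \<le> \<epsilon>\<close> resting on the ray at \<open>1\<close>, with \<open>z = 1 + s + i y\<close>, the
  harmonic function \<open>1 - \<epsilon> + 3/\<epsilon> (s\<^sup>2 - y\<^sup>2 + 2 \<epsilon> y)\<close> is at least \<open>1 - \<epsilon>\<close> on the bottom side and at least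
  \<open>1 + 2 \<epsilon> \<ge> \<bar>z\<bar>\<close> on the other three. If \<open>f\<close> grew too slowly along the ray, it would majorize
  \<open>ln \<bar>f (t z)\<bar> / t\<close> and so contradict the existence of large values near the ray.\<close>

lemma not_small_on_ray:
  assumes "norm u = 1" "b < 1"
  shows "\<not> (\<forall>\<^sub>F r in at_top. norm (f (of_real r * u)) \<le> exp (b * r))"
proof
  assume "\<forall>\<^sub>F r in at_top. norm (f (of_real r * u)) \<le> exp (b * r)"
  then obtain r0 where r0: "\<And>r. r \<ge> r0 \<Longrightarrow> norm (f (of_real r * u)) \<le> exp (b * r)"
    by (auto simp: eventually_at_top_linorder)
  \<comment> \<open>The second entry gives \<open>b \<le> 1 - 2 * \<epsilon>\<close>, so on the
    bottom side the exponent is at most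
    \<open>(1 - 2 * \<epsilon>) * (1 + \<epsilon>) \<le> 1 - \<epsilon>\<close>. The first keeps the
    square in \<open>Re z \<ge> 1/2\<close>, where \<open>t \<ge> 2 * r0\<close> makes the
    assumption on the ray available.\<close>
  define \<epsilon> where "\<epsilon> = min (1/2) ((1 - b) / 2)"
  have \<epsilon>: "0 < \<epsilon>" "\<epsilon> \<le> 1/2" "b \<le> 1 - 2 * \<epsilon>"
  proof -
    have "\<epsilon> \<le> (1 - b) / 2" unfolding \<epsilon>_def by (rule min.cobounded2)
    then show "b \<le> 1 - 2 * \<epsilon>" by simp
  qed (use \<open>b < 1\<close> in \<open>simp_all add: \<epsilon>_def\<close>)
  \<comment> \<open>Small enough that \<open>h\<close> stays below \<open>1 - 2 * \<delta>\<close>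
    at all points within \<delta> of \<open>Complex 1 \<delta>\<close>, whereas a large value there
    would force at least \<open>1 - 2 * \<delta>\<close>.\<close>
  define \<delta> where "\<delta> = \<epsilon> / 20"
  have "\<delta> > 0" using \<epsilon> by (simp add: \<delta>_def)
  define h where "h s y = 1 - \<epsilon> + 3 / \<epsilon> * (s\<^sup>2 - y\<^sup>2 + 2 * \<epsilon> * y)" for s y
  \<comment> \<open>An entire function whose real part is \<open>h\<close> in the coordinates
    \<open>s = Re z - 1\<close>, \<open>y = Im z\<close>.\<close>
  define g where "g z = of_real (1 - \<epsilon>) + of_real (3 / \<epsilon>) * ((z - 1)\<^sup>2 - 2 * \<i> * of_real \<epsilon> * (z - 1))" for z
  have Re_g: "Re (g z) = h (Re z - 1) (Im z)" for z
    by (simp add: g_def h_def Re_power2)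
  have h_ge: "1 + 2 * \<epsilon> \<le> h s y" if "\<epsilon>\<^sup>2 \<le> s\<^sup>2 - y\<^sup>2 + 2 * \<epsilon> * y" for s y
  proof -
    have "3 / \<epsilon> * \<epsilon>\<^sup>2 \<le> 3 / \<epsilon> * (s\<^sup>2 - y\<^sup>2 + 2 * \<epsilon> * y)"
      using that \<epsilon> by (intro mult_left_mono) auto
    then show ?thesis using \<epsilon> by (simp add: h_def power2_eq_square)
  qed
  define S where "S = cbox (Complex (1 - \<epsilon>) 0) (Complex (1 + \<epsilon>) \<epsilon>)"
  have majorant: "norm (f (of_real t * (u * z))) \<le> exp (t * h (Re z - 1) (Im z))"
    if t: "t \<ge> 2 * r0" "t > 0" and "z \<in> S" for t z
  proof -
    \<comment> \<open>Division by \<open>exp (of_real t * g z)\<close> turns the claim into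
      \<open>norm (\<Phi> z) \<le> 1\<close>, which the maximum principle carries over from the
      frontier of the square.\<close>
    define \<Phi> where "\<Phi> z = f (of_real t * (u * z)) * exp (- of_real t * g z)" for z
    have norm_\<Phi>: "norm (\<Phi> z) = norm (f (of_real t * (u * z))) * exp (- t * h (Re z - 1) (Im z))" for z
      by (simp add: \<Phi>_def norm_mult Re_g)
    have hol: "\<Phi> holomorphic_on A" for A
      unfolding \<Phi>_def g_def
      by (intro holomorphic_intros holomorphic_on_compose_gen[OF _ holomorphic, unfolded o_def]) auto
    have "norm (\<Phi> z) \<le> 1"
    proof (rule maximum_modulus_frontier[of \<Phi> S])
      show "bounded S" by (simp add: S_def)
      fix w assume "w \<in> frontier S"
      then have z: "1 - \<epsilon> \<le> Re w" "Re w \<le> 1 + \<epsilon>" "0 \<le> Im w" "Im w \<le> \<epsilon>"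
        and side: "Re w = 1 - \<epsilon> \<or> Re w = 1 + \<epsilon> \<or> Im w = 0 \<or> Im w = \<epsilon>"
        by (auto simp: S_def frontier_cbox in_cbox_complex_iff in_box_complex_iff)
      have "norm (f (of_real t * (u * w))) \<le> exp (t * h (Re w - 1) (Im w))"
      proof (cases "Im w = 0")
        case True
        then have z_eq: "w = of_real (Re w)" by (simp add: complex_eq_iff)
        have "r0 \<le> t * (1 / 2)" using t by simp
        also have "\<dots> \<le> t * Re w" using z \<epsilon> t by (intro mult_left_mono) auto
        finally have "norm (f (of_real (t * Re w) * u)) \<le> exp (b * (t * Re w))"
          by (rule r0)
        also have "of_real (t * Re w) * u = of_real t * (u * w)"
          by (subst (2) z_eq) simp
        finally have "norm (f (of_real t * (u * w))) \<le> exp (b * (t * Re w))" .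
        also have "b * (t * Re w) = t * (b * Re w)" by simp
        also have "b * Re w \<le> (1 - 2 * \<epsilon>) * Re w"
          using z \<epsilon> by (intro mult_right_mono) auto
        also have "\<dots> \<le> (1 - 2 * \<epsilon>) * (1 + \<epsilon>)"
          using z \<epsilon> by (intro mult_left_mono) auto
        also have "\<dots> \<le> 1 - \<epsilon>"
          by (simp add: algebra_simps)
        also have "\<dots> \<le> h (Re w - 1) (Im w)"
          using \<epsilon> True by (simp add: h_def)
        finally show ?thesis using t by simp
      next
        case False
        have "0 \<le> Im w * (2 * \<epsilon> - Im w)" using z \<epsilon> by simp
        then have "0 \<le> 2 * \<epsilon> * Im w - (Im w)\<^sup>2"
          by (simp add: power2_eq_square algebra_simps)
        \<comment> \<open>On the vertical sides the square of \<open>Re w - 1\<close> is already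
          \<open>\<epsilon>\<^sup>2\<close> and the remaining terms are nonnegative; on the top side
          the remaining terms equal \<open>\<epsilon>\<^sup>2\<close>.\<close>
        moreover have "(Re w - 1)\<^sup>2 = \<epsilon>\<^sup>2 \<or> Im w = \<epsilon>"
          using side False by (auto simp: power2_eq_square)
        ultimately have "\<epsilon>\<^sup>2 \<le> (Re w - 1)\<^sup>2 - (Im w)\<^sup>2 + 2 * \<epsilon> * Im w"
          using zero_le_power2[of "Re w - 1"] by (auto simp: power2_eq_square simp del: zero_le_power2)
        then have "1 + 2 * \<epsilon> \<le> h (Re w - 1) (Im w)"
          by (rule h_ge)
        moreover have "norm w \<le> 1 + 2 * \<epsilon>"
          using z \<epsilon> cmod_le[of w] by simp
        moreover have "norm (f (of_real t * (u * w))) \<le> exp (t * norm w)"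
          using norm_le_exp[of "of_real t * (u * w)"] t assms by (simp add: norm_mult)
        ultimately show ?thesis
          using t by (elim order_trans) (simp add: mult_left_mono)
      qed
      then show "norm (\<Phi> w) \<le> 1"
        unfolding norm_\<Phi> by (simp add: exp_minus field_simps)
    qed (use hol \<open>z \<in> S\<close> in \<open>auto intro: holomorphic_on_imp_continuous_on\<close>)
    then show ?thesis
      unfolding norm_\<Phi> by (simp add: exp_minus field_simps)
  qed
  have "\<forall>\<^sub>F t in at_top. t \<ge> 2 * r0 \<and> t > 0 \<and> (\<forall>z. norm z \<le> 2 \<longrightarrow>
    (\<exists>w. norm (w - z) \<le> \<delta> \<and> f (of_real t * w) \<noteq> 0 \<and>
         norm w - ln (norm (f (of_real t * w))) / t \<le> \<delta>))"
    using large_nearby[OF \<open>\<delta> > 0\<close>, of 2]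
    by (intro eventually_conj eventually_ge_at_top eventually_gt_at_top)
  then obtain t where t: "t \<ge> 2 * r0" "t > 0"
    and near: "\<And>z. norm z \<le> 2 \<Longrightarrow> \<exists>w. norm (w - z) \<le> \<delta> \<and> f (of_real t * w) \<noteq> 0 \<and>
         norm w - ln (norm (f (of_real t * w))) / t \<le> \<delta>"
    using eventually_happens'[OF trivial_limit_at_top_linorder] by blast
  \<comment> \<open>The point is lifted by \<delta> off the ray so that its \<delta>-neighbourhood
    stays inside the rotated square.\<close>
  have "norm (u * Complex 1 \<delta>) \<le> 2"
    using cmod_le[of "Complex 1 \<delta>"] assms \<epsilon> by (simp add: norm_mult \<delta>_def)
  then obtain w where w: "norm (w - u * Complex 1 \<delta>) \<le> \<delta>" "f (of_real t * w) \<noteq> 0"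
      "norm w - ln (norm (f (of_real t * w))) / t \<le> \<delta>"
    using near by blast
  define z where "z = w / u"
  have "u \<noteq> 0" using assms by auto
  then have w_eq: "w = u * z" by (simp add: z_def)
  have "norm (w - u * Complex 1 \<delta>) = norm (z - Complex 1 \<delta>)"
    by (simp add: w_eq norm_mult assms flip: right_diff_distrib)
  with w(1) have "norm (z - Complex 1 \<delta>) \<le> \<delta>" by simp
  then have "\<bar>Re z - 1\<bar> \<le> \<delta>" "\<bar>Im z - \<delta>\<bar> \<le> \<delta>"
    using abs_Re_le_cmod[of "z - Complex 1 \<delta>"] abs_Im_le_cmod[of "z - Complex 1 \<delta>"] by auto
  then have z: "1 - \<delta> \<le> Re z" "Re z \<le> 1 + \<delta>" "0 \<le> Im z" "Im z \<le> 2 * \<delta>"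
    by linarith+
  have "z \<in> S"
    using z \<epsilon> by (auto simp: S_def in_cbox_complex_iff \<delta>_def)
  then have "norm (f (of_real t * w)) \<le> exp (t * h (Re z - 1) (Im z))"
    unfolding w_eq by (rule majorant[OF t])
  then have "ln (norm (f (of_real t * w))) \<le> ln (exp (t * h (Re z - 1) (Im z)))"
    using w(2) by (intro ln_mono) auto
  then have "ln (norm (f (of_real t * w))) / t \<le> h (Re z - 1) (Im z)"
    using t by (simp add: field_simps)
  moreover have "1 - \<delta> \<le> norm w"
    using z(1) complex_Re_le_cmod[of z] assms by (simp add: w_eq norm_mult)
  ultimately have "1 - 2 * \<delta> \<le> h (Re z - 1) (Im z)"
    using w(3) by linarith
  also have "h (Re z - 1) (Im z) \<le> 1 - \<epsilon> + 3 / \<epsilon> * (\<delta>\<^sup>2 - 0 + 2 * \<epsilon> * (2 * \<delta>))"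
  proof -
    have "(Re z - 1)\<^sup>2 \<le> \<delta>\<^sup>2"
      using \<open>\<bar>Re z - 1\<bar> \<le> \<delta>\<close> by (simp add: abs_le_square_iff[symmetric])
    then show ?thesis
      unfolding h_def using z \<epsilon> by (intro add_mono mult_left_mono diff_mono) auto
  qed
  also have "\<dots> = 1 - \<epsilon> + 3 * \<epsilon> / 400 + 3 * \<epsilon> / 5"
    using \<epsilon> by (simp add: \<delta>_def power2_eq_square field_simps)
  finally show False
    using \<epsilon>(1) by (simp add: \<delta>_def)
qed

text \<open>The upper bound is that of \<open>f\<close> by the exponential. An upper limit below
  \<open>1\<close> would bound \<open>f\<close> along the ray by \<open>exp (b * r)\<close> with
  \<open>b < 1\<close>, contradicting \<open>not_small_on_ray\<close>.\<close>

lemma growth_indicator_eq_1: "growth_indicator 1 f \<theta> = 1"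
proof (rule antisym)
  show "growth_indicator 1 f \<theta> \<le> 1"
    unfolding growth_indicator_def
  proof (rule Limsup_bounded)
    show "\<forall>\<^sub>F r in at_top. ereal (r powr (-1)) * log_modulus (f (of_real r * cis \<theta>)) \<le> 1"
      using eventually_gt_at_top[of 0]
    proof eventually_elim
      case (elim r)
      have "ln (norm (f (of_real r * cis \<theta>))) \<le> r"
        using ln_norm_le[of "of_real r * cis \<theta>"] elim by (simp add: norm_mult)
      then show ?case
        using elim by (simp add: log_modulus_def powr_minus_divide)
    qed
  qed
  show "1 \<le> growth_indicator 1 f \<theta>"
  proof (rule ccontr)
    assume "\<not> 1 \<le> growth_indicator 1 f \<theta>"
    then obtain b where b: "growth_indicator 1 f \<theta> < ereal b" "b < 1"
      using ereal_dense2[of "growth_indicator 1 f \<theta>" 1] linorder_not_le[of 1] less_ereal.simps(1)[of _ 1, folded one_ereal_def] by auto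
    have "\<forall>\<^sub>F r in at_top. ereal (r powr (-1)) * log_modulus (f (of_real r * cis \<theta>)) < ereal b"
      using b(1) unfolding growth_indicator_def by (rule Limsup_lessD)
    then have "\<forall>\<^sub>F r in at_top. norm (f (of_real r * cis \<theta>)) \<le> exp (b * r)"
      using eventually_gt_at_top[of 0]
    proof eventually_elim
      case (elim r)
      show ?case
      proof (cases "f (of_real r * cis \<theta>) = 0")
        case False
        then have "ln (norm (f (of_real r * cis \<theta>))) < b * r"
          using elim by (simp add: log_modulus_def powr_minus_divide field_simps)
        then have "exp (ln (norm (f (of_real r * cis \<theta>)))) \<le> exp (b * r)"
          by simp
        then show ?thesis using False by simp
      qed simp
    qed
    then show False
      using not_small_on_ray[of "cis \<theta>" b] b(2) by simp
  qed
qed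

end

section \<open>Distributions induced by locally integrable functions\<close>

lemma not_in_supp: "z \<notin> supp \<phi> \<Longrightarrow> \<phi> z = 0"
  unfolding supp_def using closure_subset[of "{z. \<phi> z \<noteq> 0}"] by blast

lemma test_function_bounds:
  assumes "\<phi> \<in> test_functions"
  shows "continuous_on A \<phi>" "bounded (range \<phi>)"
proof -
  have "C_k 0 \<phi>" using assms unfolding test_functions_def smooth_def by blast
  then have cont: "continuous_on A \<phi>" for A
    using continuous_on_subset by (metis C_k.simps(1) subset_UNIV)
  then show "continuous_on A \<phi>" .
  have "compact (\<phi> ` supp \<phi>)"
    using assms by (intro compact_continuous_image cont) (simp add: test_functions_def)
  moreover have "range \<phi> \<subseteq> insert 0 (\<phi> ` supp \<phi>)"
    using not_in_supp by blast
  ultimately show "bounded (range \<phi>)"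
    by (meson bounded_insert bounded_subset compact_imp_bounded)
qed

text \<open>The integrand is dominated by \<open>M * \<bar>g z\<bar>\<close> on \<open>K\<close> and
  vanishes outside.\<close>

lemma regular_distribution_bound:
  assumes "\<phi> \<in> test_functions" and [measurable]: "g \<in> borel_measurable borel"
    and int: "set_integrable lborel K g" and K: "compact K" "supp \<phi> \<subseteq> K"
    and M: "\<And>z. norm (\<phi> z) \<le> M"
  shows "integrable lborel (\<lambda>z. g z *\<^sub>R \<phi> z)"
    and "norm (regular_distribution g \<phi>) \<le> M * (LINT z:K|lborel. \<bar>g z\<bar>)"
proof -
  have [measurable]: "\<phi> \<in> borel_measurable borel"
    by (intro borel_measurable_continuous_onI test_function_bounds assms)
  have int': "integrable lborel (\<lambda>z. M * (indicator K z * \<bar>g z\<bar>))"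
    using integrable_abs[OF int[unfolded set_integrable_def]] by (simp add: abs_mult)
  have le: "norm (g z *\<^sub>R \<phi> z) \<le> M * (indicator K z * \<bar>g z\<bar>)" for z
  proof (cases "z \<in> K")
    case True
    then show ?thesis
      using mult_right_mono[OF M[of z], of "\<bar>g z\<bar>"] by (simp add: mult.commute)
  next
    case False
    then have "\<phi> z = 0" using K not_in_supp by blast
    then show ?thesis using False by simp
  qed
  show I: "integrable lborel (\<lambda>z. g z *\<^sub>R \<phi> z)"
  proof (rule Bochner_Integration.integrable_bound[OF int'])
    have "norm (g z *\<^sub>R \<phi> z) \<le> norm (M * (indicator K z * \<bar>g z\<bar>))" for z
      by (rule order_trans[OF le]) (simp only: real_norm_def abs_ge_self)
    then show "AE z in lborel. norm (g z *\<^sub>R \<phi> z) \<le> norm (M * (indicator K z * \<bar>g z\<bar>))"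
      by (rule AE_I2)
  qed measurable
  have "norm (regular_distribution g \<phi>) \<le> (LINT z|lborel. M * (indicator K z * \<bar>g z\<bar>))"
    unfolding regular_distribution_def by (rule Bochner_Integration.integral_norm_bound_integral[OF I int' le])
  then show "norm (regular_distribution g \<phi>) \<le> M * (LINT z:K|lborel. \<bar>g z\<bar>)"
    by (simp add: set_lebesgue_integral_def)
qed

lemma regular_distribution_bound_SUP:
  assumes "\<phi> \<in> test_functions" "g \<in> borel_measurable borel"
    "set_integrable lborel K g" "compact K" "supp \<phi> \<subseteq> K"
  shows "integrable lborel (\<lambda>z. g z *\<^sub>R \<phi> z)"
    and "norm (regular_distribution g \<phi>) \<le> (SUP z. norm (\<phi> z)) * (LINT z:K|lborel. \<bar>g z\<bar>)"
proof -
  have "norm (\<phi> z) \<le> (SUP z. norm (\<phi> z))" for z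
  proof -
    obtain b where "\<And>z. norm (\<phi> z) \<le> b"
      using test_function_bounds(2)[OF assms(1)] by (auto simp: bounded_iff)
    then show ?thesis
      by (intro cSUP_upper bdd_aboveI2) auto
  qed
  note * = regular_distribution_bound[OF assms this]
  show "integrable lborel (\<lambda>z. g z *\<^sub>R \<phi> z)"
    "norm (regular_distribution g \<phi>) \<le> (SUP z. norm (\<phi> z)) * (LINT z:K|lborel. \<bar>g z\<bar>)"
    by (fact *)+
qed

text \<open>Such a functional has order \<open>0\<close>: the sup-norm of the test function itself
  suffices, so \<open>N = 0\<close>.\<close>

lemma distribution_regular_distribution:
  assumes [measurable]: "g \<in> borel_measurable borel" and g: "locally_integrable g"
  shows "distribution (regular_distribution g)"
  unfolding distribution_def
proof (intro conjI ballI allI impI)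
  have int: "integrable lborel (\<lambda>z. g z *\<^sub>R \<phi> z)" if "\<phi> \<in> test_functions" for \<phi>
    using that g by (intro regular_distribution_bound_SUP[of \<phi> g "supp \<phi>"]) (auto simp: locally_integrable_def test_functions_def)
  show "regular_distribution g (\<lambda>z. \<phi> z + \<psi> z) = regular_distribution g \<phi> + regular_distribution g \<psi>"
    if "\<phi> \<in> test_functions" "\<psi> \<in> test_functions" for \<phi> \<psi>
    unfolding regular_distribution_def using int that by (simp add: scaleR_add_right)
  show "regular_distribution g (\<lambda>z. c * \<phi> z) = c * regular_distribution g \<phi>"
    if "\<phi> \<in> test_functions" for c \<phi>
    using integral_mult_right_zero[of lborel c "\<lambda>z. g z *\<^sub>R \<phi> z"]
    by (simp add: regular_distribution_def)
  fix K :: "complex set"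
  assume "compact K"
  define C where "C = (LINT z:K|lborel. \<bar>g z\<bar>)"
  have "norm (regular_distribution g \<phi>) \<le> C * (\<Sum>i\<le>0. \<Sum>j\<le>0. SUP z. norm (partial_deriv i j \<phi> z))"
    if "\<phi> \<in> test_functions" "supp \<phi> \<subseteq> K" for \<phi>
    using regular_distribution_bound_SUP(2)[OF that(1) assms(1) _ \<open>compact K\<close> that(2)] g \<open>compact K\<close>
    by (simp add: C_def locally_integrable_def partial_deriv_def mult.commute)
  then show "\<exists>C N. \<forall>\<phi>\<in>test_functions. supp \<phi> \<subseteq> K \<longrightarrow>
      norm (regular_distribution g \<phi>) \<le> C * (\<Sum>i\<le>N. \<Sum>j\<le>N. SUP z. norm (partial_deriv i j \<phi> z))"
    by blast
qed

lemma continuous_imp_locally_integrable: "continuous_on UNIV g \<Longrightarrow> locally_integrable g"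
  unfolding locally_integrable_def set_integrable_def
proof (intro allI impI borel_integrable_compact)
  show "continuous_on K g" if "continuous_on UNIV g" for K :: "complex set"
    using that by (rule continuous_on_subset) simp
qed

section \<open>Completely regular growth\<close>

context pantograph
begin

lemma locally_integrable_deficit: "t > 0 \<Longrightarrow> locally_integrable (deficit t)"
  unfolding locally_integrable_def
proof (intro allI impI)
  fix K :: "complex set" assume "t > 0" "compact K"
  then obtain R where "K \<subseteq> ball 0 R"
    using bounded_subset_ballD[OF compact_imp_bounded] by blast
  then have "K \<subseteq> cball 0 R"
    using ball_subset_cball by (rule order_trans)
  moreover have "K \<in> sets lborel"
    using \<open>compact K\<close> by (simp add: borel_compact)
  ultimately show "set_integrable lborel K (deficit t)"
    by (intro set_integrable_subset[OF integrable_deficit[OF \<open>t > 0\<close>]])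
qed

text \<open>Tested against \<open>\<phi>\<close>, the difference from the limit is minus the
  integral of \<open>deficit t\<close> times \<open>\<phi>\<close>. It is at most the sup-norm of
  \<open>\<phi>\<close> times the integral of the deficit over a disc containing the
  support.\<close>

lemma tendsto_distribution_norm:
  "tendsto_distribution (\<lambda>t z. t powr (-1) * ln (norm (f (of_real t * z)))) (regular_distribution norm) at_top"
  unfolding tendsto_distribution_def
proof (intro conjI ballI)
  have norm: "locally_integrable norm"
    by (intro continuous_imp_locally_integrable continuous_intros)
  then show "distribution (regular_distribution norm)"
    by (intro distribution_regular_distribution) auto
  have eq: "(\<lambda>z. t powr (-1) * ln (norm (f (of_real t * z)))) = (\<lambda>z. norm z - deficit t z)" if "t > 0" for t
    using that by (simp add: deficit_def powr_minus_divide)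
  show "\<forall>\<^sub>F t in at_top. locally_integrable (\<lambda>z. t powr (-1) * ln (norm (f (of_real t * z))))"
    using eventually_gt_at_top[of 0]
  proof eventually_elim
    case (elim t)
    show ?case
      unfolding eq[OF elim] locally_integrable_def
    proof (intro allI impI set_integral_diff(1))
      fix K :: "complex set" assume "compact K"
      then show "set_integrable lborel K norm" "set_integrable lborel K (deficit t)"
        using norm locally_integrable_deficit[OF elim] by (simp_all add: locally_integrable_def)
    qed
  qed
  fix \<phi> assume \<phi>: "\<phi> \<in> test_functions"
  define M where "M = (SUP z. norm (\<phi> z))"
  have "compact (supp \<phi>)"
    using \<phi> by (simp add: test_functions_def)
  then obtain R where "R > 0" and "supp \<phi> \<subseteq> ball 0 R"
    using bounded_subset_ballD[OF compact_imp_bounded] by blast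
  then have R: "supp \<phi> \<subseteq> cball 0 R"
    using ball_subset_cball by blast
  have "\<forall>\<^sub>F t in at_top. norm (regular_distribution (\<lambda>z. t powr (-1) * ln (norm (f (of_real t * z)))) \<phi>
      - regular_distribution norm \<phi>) \<le> M * (LINT z:cball 0 R|lborel. deficit t z)"
    using eventually_gt_at_top[of 0]
  proof eventually_elim
    case (elim t)
    have "set_integrable lborel (cball (0::complex) R) norm"
      using norm by (simp add: locally_integrable_def)
    then have int: "integrable lborel (\<lambda>z. norm z *\<^sub>R \<phi> z)"
      by (intro regular_distribution_bound_SUP(1)[OF \<phi> _ _ _ R]) auto
    have int': "integrable lborel (\<lambda>z. deficit t z *\<^sub>R \<phi> z)"
      using integrable_deficit[OF elim] by (intro regular_distribution_bound_SUP(1)[OF \<phi> _ _ _ R]) auto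
    have "regular_distribution (\<lambda>z. t powr (-1) * ln (norm (f (of_real t * z)))) \<phi> - regular_distribution norm \<phi>
        = - regular_distribution (deficit t) \<phi>"
      unfolding eq[OF elim] regular_distribution_def scaleR_diff_left
      by (subst Bochner_Integration.integral_diff[OF int int']) simp
    moreover have "norm (regular_distribution (deficit t) \<phi>) \<le> M * (LINT z:cball 0 R|lborel. \<bar>deficit t z\<bar>)"
      unfolding M_def using integrable_deficit[OF elim] R \<phi>
      by (intro regular_distribution_bound_SUP(2)) auto
    ultimately show ?case
      by (simp add: deficit_nonneg[OF elim])
  qed
  moreover have "((\<lambda>t. M * (LINT z:cball 0 R|lborel. deficit t z)) \<longlongrightarrow> 0) at_top"
    using \<open>R > 0\<close> by (intro tendsto_mult_right_zero integral_deficit_tendsto_0) simp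
  ultimately have "((\<lambda>t. regular_distribution (\<lambda>z. t powr (-1) * ln (norm (f (of_real t * z)))) \<phi>
      - regular_distribution norm \<phi>) \<longlongrightarrow> 0) at_top"
    by (rule Lim_null_comparison)
  then show "((\<lambda>t. regular_distribution (\<lambda>z. t powr (-1) * ln (norm (f (of_real t * z)))) \<phi>)
      \<longlongrightarrow> regular_distribution norm \<phi>) at_top"
    by (rule LIM_zero_cancel)
qed

lemma completely_regular_growth: "completely_regular_growth 1 f"
  unfolding completely_regular_growth_def normal_type_def growth_type_1
proof (intro conjI)
  show "\<exists>u. tendsto_distribution (\<lambda>t z. t powr - 1 * ln (norm (f (of_real t * z)))) u at_top"
    by (rule exI[where x = "regular_distribution norm"]) (rule tendsto_distribution_norm)
qed (simp_all add: holomorphic has_growth_order_1)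

end

section \<open>The given series as a solution of the pantograph equation\<close>

theorem theorem3:
  fixes \<alpha> :: real and f :: "complex \<Rightarrow> complex"
  assumes "\<alpha> \<notin> \<rat>"
    and "\<And>z. f z = (\<Sum>n. exp (2 * of_real pi * \<i> * of_nat n ^ 2 * of_real \<alpha>) * (z ^ n / fact n))"
  shows "completely_regular_growth 1 f \<and> (\<forall>\<theta>. growth_indicator 1 f \<theta> = 1)"
proof -
  define e where "e n = cis (2 * pi * \<alpha> * real n ^ 2)" for n
  define a where "a n = e n / fact n" for n
  define q where "q = cis (4 * pi * \<alpha>)"
  \<comment> \<open>This is \<open>(n + 1)\<^sup>2 = 1 + 2 * n + n\<^sup>2\<close> in the exponent;
    the cross term \<open>2 * n\<close> explains the angle \<open>4 * pi * \<alpha>\<close> of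
    \<open>q\<close>.\<close>
  have e_Suc: "e (Suc n) = e 1 * q ^ n * e n" for n
    by (simp add: e_def q_def Complex.DeMoivre cis_mult power2_eq_square algebra_simps)
  have f_eq: "f z = (\<Sum>n. a n * z ^ n)" for z
  proof -
    have "exp (2 * of_real pi * \<i> * of_nat n ^ 2 * of_real \<alpha>) = e n" for n
      by (simp add: e_def cis_conv_exp mult_ac)
    then show ?thesis by (simp add: assms(2) a_def)
  qed
  have summable: "summable (\<lambda>n. a n * z ^ n)" for z
  proof (rule summable_comparison_test)
    show "\<exists>N. \<forall>n\<ge>N. norm (a n * z ^ n) \<le> norm z ^ n / fact n"
      by (simp add: a_def e_def norm_mult norm_divide norm_power)
    show "summable (\<lambda>n. norm z ^ n / fact n)"
      using summable_exp[of "norm z"] by (simp add: field_simps)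
  qed
  \<comment> \<open>The factor \<open>Suc n\<close> cancels against the factorial, so termwise
    differentiation yields the pantograph equation.\<close>
  have diffs: "diffs a n = e 1 * (a n * q ^ n)" for n
    by (simp add: diffs_def a_def e_Suc[of n] del: of_nat_Suc)
  have deriv: "(f has_field_derivative e 1 * f (q * z)) (at z)" for z
  proof -
    have "((\<lambda>z. \<Sum>n. a n * z ^ n) has_field_derivative (\<Sum>n. diffs a n * z ^ n)) (at z)"
      by (intro termdiffs_strong_converges_everywhere summable)
    moreover have "(\<Sum>n. diffs a n * z ^ n) = e 1 * f (q * z)"
      unfolding f_eq diffs using suminf_mult[OF summable[of "q * z"], of "e 1"]
      by (simp add: power_mult_distrib mult_ac)
    ultimately show ?thesis by (simp add: f_eq[abs_def])
  qed
  interpret pantograph f "e 1" q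
  proof
    show "f holomorphic_on UNIV"
      using deriv by (auto simp: holomorphic_on_open)
    show "deriv f z = e 1 * f (q * z)" for z
      using deriv by (rule DERIV_imp_deriv)
    show "norm (f 0) = 1"
      by (simp add: f_eq) (simp add: a_def e_def)
    show "norm (e 1) = 1" "norm q = 1" by (simp_all add: e_def q_def)
    show "\<exists>k. norm (q ^ k - u) < \<epsilon>" if "norm u = 1" "0 < \<epsilon>" for u \<epsilon>
    proof -
      \<comment> \<open>The angle of \<open>q\<close> is \<open>2 * \<alpha>\<close> full turns, so
        density of its powers is density of the fractional parts of the multiples of
        \<open>2 * \<alpha>\<close>.\<close>
      have "2 * \<alpha> \<notin> \<rat>"
        using assms(1) Rats_divide[of "2 * \<alpha>" 2] by auto
      moreover have "\<epsilon> / (2 * pi) > 0" using \<open>\<epsilon> > 0\<close> by simp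
      ultimately obtain h k where "k > 0"
        and hk: "\<bar>of_int k * (2 * \<alpha>) - of_int h - Arg u / (2 * pi)\<bar> < \<epsilon> / (2 * pi)"
        by (rule sequence_of_fractional_parts_is_dense)
      have u: "cis (Arg u) = u"
        using rcis_cmod_Arg[of u] \<open>norm u = 1\<close> by (simp add: rcis_def)
      have "q ^ nat k = cis (of_int k * (4 * pi * \<alpha>))"
        using \<open>k > 0\<close> by (simp add: q_def Complex.DeMoivre)
      also have "\<dots> = cis (of_int k * (4 * pi * \<alpha>)) / cis (2 * pi * of_int h)"
        using cis_multiple_2pi[of "of_int h"] by simp
      also have "\<dots> = cis (of_int k * (4 * pi * \<alpha>) - 2 * pi * of_int h)"
        by (simp only: cis_divide)
      finally have "norm (q ^ nat k - u) \<le> \<bar>of_int k * (4 * pi * \<alpha>) - 2 * pi * of_int h - Arg u\<bar>"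
        using norm_cis_diff_le[of "of_int k * (4 * pi * \<alpha>) - 2 * pi * of_int h" "Arg u"]
        unfolding u by simp
      also have "of_int k * (4 * pi * \<alpha>) - 2 * pi * of_int h - Arg u
          = 2 * pi * (of_int k * (2 * \<alpha>) - of_int h - Arg u / (2 * pi))"
        by (simp add: field_simps)
      also have "\<bar>\<dots>\<bar> = 2 * pi * \<bar>of_int k * (2 * \<alpha>) - of_int h - Arg u / (2 * pi)\<bar>"
        by (simp add: abs_mult)
      also have "\<dots> < 2 * pi * (\<epsilon> / (2 * pi))"
        using hk by (intro mult_strict_left_mono) auto
      also have "\<dots> = \<epsilon>" by simp
      finally show ?thesis by blast
    qed
  qed
  show ?thesis
    using completely_regular_growth growth_indicator_eq_1 by blast
qed

end
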